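(* Let $\mathcal{G}$ be a simple graph with countable vertex set $I$ and edge set $E$, marked so that all vertices are odd isotropic, i.e. $I=I_1=I_1^{\mathrm{it}}$. Then there is a $\mathbb{C}$-vector space isomorphism $\mathbf{U}_{\mathcal{G}}\to\mathbb{C}[W_{\mathcal{G}}]$ mapping each basis element $e_{i_1}\cdots e_{i_k}$ (namely $e_{w_{\mathrm{max}}}$ with $w_{\mathrm{max}}=i_1\cdots i_k$, $[w]\in\mathcal{M}'(\mathcal{G})$) to $e(s_{i_1})\cdots e(s_{i_k})$. In particular it preserves the $\mathbb{Z}_+^I$-grading, and $$\mathcal{H}_{\mathcal{G}}(\mathbf x) = \frac{1}{\mathcal{I}(\mathcal{G},-\mathbf x)}=\left(\sum_{S\in \widetilde{\mathcal{I}}(\mathcal{G})}\ \prod_{i\in S}\frac{-x_i}{1+x_i}\right)^{-1}.$$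
   Context: $\mathbf{U}_{\mathcal{G}}$ is the associative $\mathbb{C}$-superalgebra generated by odd elements $e_i$ ($i\in I$) with relations $e_i^2=0$ ($i\in I$) and $e_ie_j=-e_je_i$ for $i\neq j$, $(i,j)\notin E$ (the universal enveloping algebra of the partially commutative Lie superalgebra of $\mathcal{G}$), graded by $\deg e_i=\alpha_i$. Fix a total order on $I$ and the induced lexicographic order on the free monoid $I^*$. $\mathcal{M}(\mathcal{G})=I^*/\sim$ with $\sim$ the congruence generated by $ab\sim ba$ for $(a,b)\notin E$; $w_{\mathrm{max}}$ is the lexicographically largest word in the class $[w]$; $a_i(w)$ is the largest $k$ with $[w]=[i^ku]$ for some $u$; $\mathcal{M}'(\mathcal{G})$ is the set of $[w]$ such that for all $w_1,w_2$ with $[w]=[w_1w_2]$, $a_i(w_2)\le1$ for all $i$; and $\{e_{w_{\max}}:[w]\in\mathcal{M}'(\mathcal{G})\}$ is a basis of $\mathbf{U}_{\mathcal{G}}$, where $e_{i_1\cdots i_k}=e_{i_1}\cdots e_{i_k}$. The right-angled Coxeter group $W_{\mathcal{G}}$ is generated by $s_i$ ($i\in I$) with relations $s_i^2=1$ and $s_is_j=s_js_i$ for $(i,j)\notin E$; $\mathbb{C}[W_{\mathcal{G}}]$ is its group algebra with basis $e(w)$, $w\in W_{\mathcal{G}}$, and $e(s_{i_1}\cdots s_{i_k})=e(s_{i_1})\cdots e(s_{i_k})$. For $w\in W_{\mathcal{G}}$ with reduced expression $s_{i_1}\cdots s_{i_k}$, $\mathbf{x}(w)=x_{i_1}\cdots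 x_{i_k}$, and $\mathcal{H}_{\mathcal{G}}(\mathbf x)=\sum_{w\in W_{\mathcal{G}}}\mathbf x(w)$. $\widetilde{\mathcal{I}}(\mathcal{G})$ is the set of finite independent (pairwise non-adjacent) subsets of $I$, and $\mathcal{I}(\mathcal{G},\mathbf{x})=\sum_{U}\prod_i x_i^{m_i(U)}$ summed over all finite multisets $U$ whose underlying set is independent, $m_i(U)$ being the multiplicity of $i$; $\mathcal{I}(\mathcal{G},-\mathbf{x})$ is obtained by $x_i\mapsto-x_i$. *)

theory Defs
  imports Complex_Main "HOL-Library.Countable_Set" "HOL-Library.Multiset"
    "HOL-Algebra.QuotRing" "HOL-Algebra.Module"
begin

section \<open>Presentations\<close>

inductive_set gen_cong :: "'a set \<Rightarrow> ('a list \<times> 'a list) set \<Rightarrow> ('a list \<times> 'a list) set"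
  for X :: "'a set" and R :: "('a list \<times> 'a list) set"
where
  cong_base: "(u, v) \<in> R \<Longrightarrow> (u, v) \<in> gen_cong X R"
| cong_refl: "u \<in> lists X \<Longrightarrow> (u, u) \<in> gen_cong X R"
| cong_sym: "(u, v) \<in> gen_cong X R \<Longrightarrow> (v, u) \<in> gen_cong X R"
| cong_trans: "(u, v) \<in> gen_cong X R \<Longrightarrow> (v, w) \<in> gen_cong X R \<Longrightarrow> (u, w) \<in> gen_cong X R"
| cong_append: "(u, v) \<in> gen_cong X R \<Longrightarrow> (u', v') \<in> gen_cong X R \<Longrightarrow> (u @ u', v @ v') \<in> gen_cong X R"

definition free_monoid :: "'a set \<Rightarrow> 'a list monoid" where
  "free_monoid X = \<lparr>carrier = lists X, mult = (@), one = []\<rparr>"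

definition presented_monoid :: "'a set \<Rightarrow> ('a list \<times> 'a list) set \<Rightarrow> 'a list set monoid" where
  "presented_monoid X R =
     \<lparr>carrier = lists X // gen_cong X R,
      mult = (\<lambda>A B. \<Union>u\<in>A. \<Union>v\<in>B. gen_cong X R `` {u @ v}),
      one = gen_cong X R `` {[]}\<rparr>"

text \<open>In a group presentation the letter \<open>(x, True)\<close> stands for the generator \<open>x\<close> and
  \<open>(x, False)\<close> for its formal inverse.\<close>

definition with_cancellation ::
  "'a set \<Rightarrow> (('a \<times> bool) list \<times> ('a \<times> bool) list) set \<Rightarrow>
   (('a \<times> bool) list \<times> ('a \<times> bool) list) set" where
  "with_cancellation X R = R \<union> {([(x, b), (x, \<not> b)], []) | x b. x \<in> X}"

definition presented_group ::
  "'a set \<Rightarrow> (('a \<times> bool) list \<times> ('a \<times> bool) list) set \<Rightarrow> ('a \<times> bool) list set monoid" where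
  "presented_group X R = presented_monoid (X \<times> UNIV) (with_cancellation X R)"

definition list_prod :: "('a, 'm) monoid_scheme \<Rightarrow> 'a list \<Rightarrow> 'a" where
  "list_prod G xs = foldr (mult G) xs (one G)"


section \<open>Monoid algebras over the complex numbers\<close>

definition monoid_algebra :: "('a, 'm) monoid_scheme \<Rightarrow> (complex, 'a \<Rightarrow> complex) module" where
  "monoid_algebra G =
     \<lparr>carrier = {f. finite {x. f x \<noteq> 0} \<and> {x. f x \<noteq> 0} \<subseteq> carrier G},
      mult = (\<lambda>f g x. \<Sum>u | f u \<noteq> 0. \<Sum>v | g v \<noteq> 0. if u \<otimes>\<^bsub>G\<^esub> v = x then f u * g v else 0),
      one = (\<lambda>x. if x = \<one>\<^bsub>G\<^esub> then 1 else 0),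
      zero = (\<lambda>x. 0),
      add = (\<lambda>f g x. f x + g x),
      smult = (\<lambda>c f x. c * f x)\<rparr>"

definition basis_elt :: "'a \<Rightarrow> 'a \<Rightarrow> complex" where
  "basis_elt a = (\<lambda>x. if x = a then 1 else 0)"

definition homogeneous :: "('a, 'm) monoid_scheme \<Rightarrow> ('a \<Rightarrow> 'd) \<Rightarrow> 'd \<Rightarrow> ('a \<Rightarrow> complex) set" where
  "homogeneous G wt d = {f \<in> carrier (monoid_algebra G). \<forall>x. f x \<noteq> 0 \<longrightarrow> wt x = d}"

definition quotient_algebra :: "('c, 'a, 'm) module_scheme \<Rightarrow> 'a set \<Rightarrow> ('c, 'a set) module" where
  "quotient_algebra A J =
     \<lparr>carrier = carrier (A Quot J), mult = mult (A Quot J), one = one (A Quot J),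
      zero = zero (A Quot J), add = add (A Quot J),
      smult = (\<lambda>c B. \<Union>b\<in>B. J +>\<^bsub>A\<^esub> (c \<odot>\<^bsub>A\<^esub> b))\<rparr>"

definition vector_space_iso ::
  "(complex, 'a, 'm) module_scheme \<Rightarrow> (complex, 'b, 'n) module_scheme \<Rightarrow> ('a \<Rightarrow> 'b) set" where
  "vector_space_iso V W =
     {h. bij_betw h (carrier V) (carrier W) \<and>
         (\<forall>x \<in> carrier V. \<forall>y \<in> carrier V. h (x \<oplus>\<^bsub>V\<^esub> y) = h x \<oplus>\<^bsub>W\<^esub> h y) \<and>
         (\<forall>c. \<forall>x \<in> carrier V. h (c \<odot>\<^bsub>V\<^esub> x) = c \<odot>\<^bsub>W\<^esub> h x)}"


section \<open>The algebra $\mathbf{U}_{\mathcal{G}}$\<close>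

text \<open>A graph is given by its vertex set \<open>I\<close> and a symmetric irreflexive set \<open>E\<close> of ordered
  pairs of vertices. All vertices are odd isotropic. Degrees in $\mathbb{Z}_+^I$, i.e. finitely
  supported exponent vectors, are finite multisets over \<open>I\<close>.\<close>

definition free_algebra :: "'i set \<Rightarrow> (complex, 'i list \<Rightarrow> complex) module" where
  "free_algebra I = monoid_algebra (free_monoid I)"

definition U_relators :: "'i set \<Rightarrow> ('i \<times> 'i) set \<Rightarrow> ('i list \<Rightarrow> complex) set" where
  "U_relators I E =
     (let F = free_algebra I; e = (\<lambda>i. basis_elt [i]) in
        {e i \<otimes>\<^bsub>F\<^esub> e i | i. i \<in> I} \<union>
        {(e i \<otimes>\<^bsub>F\<^esub> e j) \<oplus>\<^bsub>F\<^esub> (e j \<otimes>\<^bsub>F\<^esub> e i) | i j. i \<in> I \<and> j \<in> I \<and> i \<noteq> j \<and> (i, j) \<notin> E})"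

definition U_ideal :: "'i set \<Rightarrow> ('i \<times> 'i) set \<Rightarrow> ('i list \<Rightarrow> complex) set" where
  "U_ideal I E = genideal (free_algebra I) (U_relators I E)"

definition U_algebra :: "'i set \<Rightarrow> ('i \<times> 'i) set \<Rightarrow> (complex, ('i list \<Rightarrow> complex) set) module" where
  "U_algebra I E = quotient_algebra (free_algebra I) (U_ideal I E)"

definition U_gen :: "'i set \<Rightarrow> ('i \<times> 'i) set \<Rightarrow> 'i \<Rightarrow> ('i list \<Rightarrow> complex) set" where
  "U_gen I E i = U_ideal I E +>\<^bsub>free_algebra I\<^esub> basis_elt [i]"

definition U_word :: "'i set \<Rightarrow> ('i \<times> 'i) set \<Rightarrow> 'i list \<Rightarrow> ('i list \<Rightarrow> complex) set" where
  "U_word I E w = list_prod (U_algebra I E) (map (U_gen I E) w)"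

definition U_component ::
  "'i set \<Rightarrow> ('i \<times> 'i) set \<Rightarrow> 'i multiset \<Rightarrow> ('i list \<Rightarrow> complex) set set" where
  "U_component I E \<alpha> =
     (\<lambda>f. U_ideal I E +>\<^bsub>free_algebra I\<^esub> f) ` homogeneous (free_monoid I) mset \<alpha>"


section \<open>The partially commutative monoid\<close>

definition commutations :: "'i set \<Rightarrow> ('i \<times> 'i) set \<Rightarrow> ('i list \<times> 'i list) set" where
  "commutations I E = {([a, b], [b, a]) | a b. a \<in> I \<and> b \<in> I \<and> (a, b) \<notin> E}"

definition pc_monoid :: "'i set \<Rightarrow> ('i \<times> 'i) set \<Rightarrow> 'i list set monoid" where
  "pc_monoid I E = presented_monoid I (commutations I E)"

definition pc_class :: "'i set \<Rightarrow> ('i \<times> 'i) set \<Rightarrow> 'i list \<Rightarrow> 'i list set" where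
  "pc_class I E w = gen_cong I (commutations I E) `` {w}"

definition init_mult :: "'i set \<Rightarrow> ('i \<times> 'i) set \<Rightarrow> 'i \<Rightarrow> 'i list \<Rightarrow> nat" where
  "init_mult I E i w =
     (GREATEST k. \<exists>u \<in> lists I. pc_class I E w = pc_class I E (replicate k i @ u))"

definition pc_monoid' :: "'i set \<Rightarrow> ('i \<times> 'i) set \<Rightarrow> 'i list set set" where
  "pc_monoid' I E =
     {c \<in> carrier (pc_monoid I E).
        \<forall>w\<^sub>1 \<in> lists I. \<forall>w\<^sub>2 \<in> lists I. c = pc_class I E (w\<^sub>1 @ w\<^sub>2) \<longrightarrow>
          (\<forall>i \<in> I. init_mult I E i w\<^sub>2 \<le> 1)}"

text \<open>\<open>r\<close> is the reflexive (non-strict) total order on the letters.\<close>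

definition max_word :: "('i \<times> 'i) set \<Rightarrow> 'i list set \<Rightarrow> 'i list" where
  "max_word r c = (THE v. v \<in> c \<and> (\<forall>u \<in> c. u = v \<or> (u, v) \<in> lexord (r - Id)))"


section \<open>The right-angled Coxeter group and its group algebra\<close>

definition coxeter_relations ::
  "'i set \<Rightarrow> ('i \<times> 'i) set \<Rightarrow> (('i \<times> bool) list \<times> ('i \<times> bool) list) set" where
  "coxeter_relations I E =
     {([(i, True), (i, True)], []) | i. i \<in> I} \<union>
     {([(i, True), (j, True)], [(j, True), (i, True)]) | i j. i \<in> I \<and> j \<in> I \<and> (i, j) \<notin> E}"

definition coxeter_group :: "'i set \<Rightarrow> ('i \<times> 'i) set \<Rightarrow> ('i \<times> bool) list set monoid" where
  "coxeter_group I E = presented_group I (coxeter_relations I E)"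

definition coxeter_gen :: "'i set \<Rightarrow> ('i \<times> 'i) set \<Rightarrow> 'i \<Rightarrow> ('i \<times> bool) list set" where
  "coxeter_gen I E i =
     gen_cong (I \<times> UNIV) (with_cancellation I (coxeter_relations I E)) `` {[(i, True)]}"

definition expression ::
  "'i set \<Rightarrow> ('i \<times> 'i) set \<Rightarrow> ('i \<times> bool) list set \<Rightarrow> 'i list \<Rightarrow> bool" where
  "expression I E w u \<longleftrightarrow>
     u \<in> lists I \<and> list_prod (coxeter_group I E) (map (coxeter_gen I E) u) = w"

definition reduced_expression ::
  "'i set \<Rightarrow> ('i \<times> 'i) set \<Rightarrow> ('i \<times> bool) list set \<Rightarrow> 'i list \<Rightarrow> bool" where
  "reduced_expression I E w u \<longleftrightarrow>
     expression I E w u \<and> (\<forall>v. expression I E w v \<longrightarrow> length u \<le> length v)"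

text \<open>The exponent vector of $\mathbf{x}(w)$; it does not depend on the chosen reduced
  expression.\<close>

definition coxeter_weight ::
  "'i set \<Rightarrow> ('i \<times> 'i) set \<Rightarrow> ('i \<times> bool) list set \<Rightarrow> 'i multiset" where
  "coxeter_weight I E w = mset (SOME u. reduced_expression I E w u)"

definition coxeter_algebra ::
  "'i set \<Rightarrow> ('i \<times> 'i) set \<Rightarrow> (complex, ('i \<times> bool) list set \<Rightarrow> complex) module" where
  "coxeter_algebra I E = monoid_algebra (coxeter_group I E)"

definition coxeter_component ::
  "'i set \<Rightarrow> ('i \<times> 'i) set \<Rightarrow> 'i multiset \<Rightarrow> (('i \<times> bool) list set \<Rightarrow> complex) set" where
  "coxeter_component I E \<alpha> = homogeneous (coxeter_group I E) (coxeter_weight I E) \<alpha>"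


section \<open>Formal power series in the variables $x_i$, $i \in I$\<close>

text \<open>A power series is its coefficient function; the multiset \<open>m\<close> encodes the monomial
  $\prod_i x_i^{m_i}$ with \<open>m\<^sub>i = count m i\<close>.\<close>

definition pow_series :: "'i set \<Rightarrow> ('i multiset \<Rightarrow> int) ring" where
  "pow_series I =
     \<lparr>carrier = {f. \<forall>m. f m \<noteq> 0 \<longrightarrow> set_mset m \<subseteq> I},
      mult = (\<lambda>f g m. \<Sum>k | k \<subseteq># m. f k * g (m - k)),
      one = (\<lambda>m. if m = {#} then 1 else 0),
      zero = (\<lambda>m. 0),
      add = (\<lambda>f g m. f m + g m)\<rparr>"

definition monomial :: "'i multiset \<Rightarrow> 'i multiset \<Rightarrow> int" where
  "monomial k = (\<lambda>m. if m = k then 1 else 0)"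

definition ps_var :: "'i \<Rightarrow> 'i multiset \<Rightarrow> int" where
  "ps_var i = monomial {#i#}"

text \<open>The sum of a possibly infinite family of power series in which every monomial occurs in only
  finitely many members.\<close>

definition formal_sum :: "'a set \<Rightarrow> ('a \<Rightarrow> 'i multiset \<Rightarrow> int) \<Rightarrow> 'i multiset \<Rightarrow> int" where
  "formal_sum A f = (\<lambda>m. \<Sum>a | a \<in> A \<and> f a m \<noteq> 0. f a m)"

text \<open>The substitution $x_i \mapsto -x_i$ for all \<open>i\<close>.\<close>

definition negate_vars :: "('i multiset \<Rightarrow> int) \<Rightarrow> 'i multiset \<Rightarrow> int" where
  "negate_vars f = (\<lambda>m. (- 1) ^ size m * f m)"

definition coxeter_series :: "'i set \<Rightarrow> ('i \<times> 'i) set \<Rightarrow> 'i multiset \<Rightarrow> int" where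
  "coxeter_series I E =
     formal_sum (carrier (coxeter_group I E)) (\<lambda>w. monomial (coxeter_weight I E w))"

definition independent_sets :: "'i set \<Rightarrow> ('i \<times> 'i) set \<Rightarrow> 'i set set" where
  "independent_sets I E = {S. finite S \<and> S \<subseteq> I \<and> (\<forall>i \<in> S. \<forall>j \<in> S. (i, j) \<notin> E)}"

definition independence_series :: "'i set \<Rightarrow> ('i \<times> 'i) set \<Rightarrow> 'i multiset \<Rightarrow> int" where
  "independence_series I E = formal_sum {U. set_mset U \<in> independent_sets I E} monomial"

definition independent_set_series :: "'i set \<Rightarrow> ('i \<times> 'i) set \<Rightarrow> 'i multiset \<Rightarrow> int" where
  "independent_set_series I E =
     (let P = pow_series I in
        formal_sum (independent_sets I E)
          (\<lambda>S. \<Otimes>\<^bsub>P\<^esub>i\<in>S. (\<ominus>\<^bsub>P\<^esub> ps_var i) \<otimes>\<^bsub>P\<^esub> inv\<^bsub>P\<^esub> (\<one>\<^bsub>P\<^esub> \<oplus>\<^bsub>P\<^esub> ps_var i)))"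


section \<open>The structures above satisfy the expected axioms\<close>


lemma monoid_free_monoid: "monoid (free_monoid X)"
  by unfold_locales (auto simp: free_monoid_def)

lemma conv_superset:
  assumes "finite A" "finite B" "{x. f x \<noteq> 0} \<subseteq> A" "{x. g x \<noteq> 0} \<subseteq> B"
  shows "(f \<otimes>\<^bsub>monoid_algebra G\<^esub> g) x =
    (\<Sum>u\<in>A. \<Sum>v\<in>B. if u \<otimes>\<^bsub>G\<^esub> v = x then f u * g v else 0)"
proof -
  have "(\<Sum>u | f u \<noteq> 0. \<Sum>v | g v \<noteq> 0. if u \<otimes>\<^bsub>G\<^esub> v = x then f u * g v else 0)
     = (\<Sum>u | f u \<noteq> 0. \<Sum>v\<in>B. if u \<otimes>\<^bsub>G\<^esub> v = x then f u * g v else 0)"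
    by (intro sum.cong refl sum.mono_neutral_left) (use assms in auto)
  also have "\<dots> = (\<Sum>u\<in>A. \<Sum>v\<in>B. if u \<otimes>\<^bsub>G\<^esub> v = x then f u * g v else 0)"
    by (intro sum.mono_neutral_left) (use assms in \<open>auto intro!: sum.neutral split: if_splits\<close>)
  finally show ?thesis by (simp add: monoid_algebra_def)
qed

lemma sum_rotate3: "(\<Sum>q\<in>Q. \<Sum>v\<in>A. \<Sum>w\<in>B. T q v w) = (\<Sum>v\<in>A. \<Sum>w\<in>B. \<Sum>q\<in>Q. T q v w)"
  by (subst sum.swap, rule sum.cong[OF refl], rule sum.swap)

lemma sum_rotate4: "(\<Sum>p\<in>P. \<Sum>w\<in>C. \<Sum>u\<in>A. \<Sum>v\<in>B. T p w u v) = (\<Sum>u\<in>A. \<Sum>v\<in>B. \<Sum>w\<in>C. \<Sum>p\<in>P. T p w u v)"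
proof -
  have "(\<Sum>p\<in>P. \<Sum>w\<in>C. \<Sum>u\<in>A. \<Sum>v\<in>B. T p w u v) = (\<Sum>w\<in>C. \<Sum>u\<in>A. \<Sum>p\<in>P. \<Sum>v\<in>B. T p w u v)"
    by (rule sum_rotate3)
  also have "\<dots> = (\<Sum>w\<in>C. \<Sum>u\<in>A. \<Sum>v\<in>B. \<Sum>p\<in>P. T p w u v)"
    by (rule sum.cong[OF refl], rule sum.cong[OF refl], rule sum.swap)
  also have "\<dots> = (\<Sum>u\<in>A. \<Sum>v\<in>B. \<Sum>w\<in>C. \<Sum>p\<in>P. T p w u v)"
    by (rule sum_rotate3)
  finally show ?thesis .
qed

lemma supp_conv:
  "{x. (f \<otimes>\<^bsub>monoid_algebra G\<^esub> g) x \<noteq> 0} \<subseteq>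
     (\<lambda>(u,v). u \<otimes>\<^bsub>G\<^esub> v) ` ({x. f x \<noteq> 0} \<times> {x. g x \<noteq> 0})"
proof
  fix x assume "x \<in> {x. (f \<otimes>\<^bsub>monoid_algebra G\<^esub> g) x \<noteq> 0}"
  then have "(\<Sum>u | f u \<noteq> 0. \<Sum>v | g v \<noteq> 0. if u \<otimes>\<^bsub>G\<^esub> v = x then f u * g v else 0) \<noteq> 0"
    by (simp add: monoid_algebra_def)
  then obtain u where u: "u \<in> {u. f u \<noteq> 0}"
      "(\<Sum>v | g v \<noteq> 0. if u \<otimes>\<^bsub>G\<^esub> v = x then f u * g v else 0) \<noteq> 0"
    by (rule sum.not_neutral_contains_not_neutral)
  from u(2) obtain v where v: "v \<in> {v. g v \<noteq> 0}" "(if u \<otimes>\<^bsub>G\<^esub> v = x then f u * g v else 0) \<noteq> 0"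
    by (rule sum.not_neutral_contains_not_neutral)
  from v(2) have "x = (case (u, v) of (u, v) \<Rightarrow> u \<otimes>\<^bsub>G\<^esub> v)"
    by (cases "u \<otimes>\<^bsub>G\<^esub> v = x") simp_all
  then show "x \<in> (\<lambda>(u,v). u \<otimes>\<^bsub>G\<^esub> v) ` ({x. f x \<noteq> 0} \<times> {x. g x \<noteq> 0})"
    by (rule image_eqI) (use u(1) v(1) in simp)
qed

lemma ring_monoid_algebra:
  assumes "monoid G"
  shows "ring (monoid_algebra G)"
proof -
  interpret G: monoid G by fact
  let ?A = "monoid_algebra G"
  have car: "f \<in> carrier ?A \<longleftrightarrow> finite {x. f x \<noteq> 0} \<and> {x. f x \<noteq> 0} \<subseteq> carrier G" for f
    by (simp add: monoid_algebra_def)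
  have add: "(f \<oplus>\<^bsub>?A\<^esub> g) = (\<lambda>x. f x + g x)" for f g by (simp add: monoid_algebra_def)
  have addc: "f \<oplus>\<^bsub>?A\<^esub> g \<in> carrier ?A" if "f \<in> carrier ?A" "g \<in> carrier ?A" for f g
  proof -
    have "{x. f x + g x \<noteq> 0} \<subseteq> {x. f x \<noteq> 0} \<union> {x. g x \<noteq> 0}" by auto
    then show ?thesis using that unfolding car add
      by (meson finite_UnI finite_subset le_sup_iff subset_trans)
  qed
  have mulc: "f \<otimes>\<^bsub>?A\<^esub> g \<in> carrier ?A" if "f \<in> carrier ?A" "g \<in> carrier ?A" for f g
  proof -
    have "(\<lambda>(u,v). u \<otimes>\<^bsub>G\<^esub> v) ` ({x. f x \<noteq> 0} \<times> {x. g x \<noteq> 0}) \<subseteq> carrier G"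
      using that unfolding car by auto
    with supp_conv[where f = f and g = g and G = G] show ?thesis using that unfolding car
      by (meson finite_SigmaI finite_imageI finite_subset subset_trans)
  qed
  have one: "\<one>\<^bsub>?A\<^esub> = (\<lambda>x. if x = \<one>\<^bsub>G\<^esub> then 1 else 0)" by (simp add: monoid_algebra_def)
  have assoc: "f \<otimes>\<^bsub>?A\<^esub> g \<otimes>\<^bsub>?A\<^esub> h = f \<otimes>\<^bsub>?A\<^esub> (g \<otimes>\<^bsub>?A\<^esub> h)"
    if c: "f \<in> carrier ?A" "g \<in> carrier ?A" "h \<in> carrier ?A" for f g h
  proof
    fix x
    let ?F = "{x. f x \<noteq> 0}" and ?G = "{x. g x \<noteq> 0}" and ?H = "{x. h x \<noteq> 0}"
    let ?P = "(\<lambda>(u,v). u \<otimes>\<^bsub>G\<^esub> v) ` (?F \<times> ?G)" and ?Q = "(\<lambda>(u,v). u \<otimes>\<^bsub>G\<^esub> v) ` (?G \<times> ?H)"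
    have fin: "finite ?F" "finite ?G" "finite ?H" "finite ?P" "finite ?Q" using c unfolding car by auto
    have "(f \<otimes>\<^bsub>?A\<^esub> g \<otimes>\<^bsub>?A\<^esub> h) x = (\<Sum>p\<in>?P. \<Sum>w\<in>?H. if p \<otimes>\<^bsub>G\<^esub> w = x then (f \<otimes>\<^bsub>?A\<^esub> g) p * h w else 0)"
      by (rule conv_superset) (use fin supp_conv[where f = f and g = g and G = G] in auto)
    also have "\<dots> = (\<Sum>p\<in>?P. \<Sum>w\<in>?H. \<Sum>u\<in>?F. \<Sum>v\<in>?G. if u \<otimes>\<^bsub>G\<^esub> v = p then (if p \<otimes>\<^bsub>G\<^esub> w = x then f u * g v * h w else 0) else 0)"
      unfolding conv_superset[OF fin(1,2) order_refl order_refl, where G = G]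
      by (intro sum.cong refl) (auto simp: sum_distrib_right intro!: sum.cong sum.neutral)
    also have "\<dots> = (\<Sum>u\<in>?F. \<Sum>v\<in>?G. \<Sum>w\<in>?H. \<Sum>p\<in>?P. if u \<otimes>\<^bsub>G\<^esub> v = p then (if p \<otimes>\<^bsub>G\<^esub> w = x then f u * g v * h w else 0) else 0)"
      by (rule sum_rotate4)
    also have "\<dots> = (\<Sum>u\<in>?F. \<Sum>v\<in>?G. \<Sum>w\<in>?H. if (u \<otimes>\<^bsub>G\<^esub> v) \<otimes>\<^bsub>G\<^esub> w = x then f u * g v * h w else 0)"
      by (intro sum.cong refl) (use fin in \<open>auto simp: sum.delta sum.delta'\<close>)
    also have "\<dots> = (\<Sum>u\<in>?F. \<Sum>v\<in>?G. \<Sum>w\<in>?H. if u \<otimes>\<^bsub>G\<^esub> (v \<otimes>\<^bsub>G\<^esub> w) = x then f u * g v * h w else 0)"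
      by (intro sum.cong refl) (use c in \<open>auto simp: car G.m_assoc subset_iff\<close>)
    also have "\<dots> = (\<Sum>u\<in>?F. \<Sum>v\<in>?G. \<Sum>w\<in>?H. \<Sum>q\<in>?Q. if v \<otimes>\<^bsub>G\<^esub> w = q then (if u \<otimes>\<^bsub>G\<^esub> q = x then f u * g v * h w else 0) else 0)"
      by (intro sum.cong refl) (use fin in \<open>auto simp: sum.delta sum.delta'\<close>)
    also have "\<dots> = (\<Sum>u\<in>?F. \<Sum>q\<in>?Q. \<Sum>v\<in>?G. \<Sum>w\<in>?H. if v \<otimes>\<^bsub>G\<^esub> w = q then (if u \<otimes>\<^bsub>G\<^esub> q = x then f u * g v * h w else 0) else 0)"
      by (rule sum.cong[OF refl], rule sum_rotate3[symmetric])
    also have "\<dots> = (\<Sum>u\<in>?F. \<Sum>q\<in>?Q. if u \<otimes>\<^bsub>G\<^esub> q = x then f u * (g \<otimes>\<^bsub>?A\<^esub> h) q else 0)"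
      unfolding conv_superset[OF fin(2,3) order_refl order_refl, where G = G]
      by (intro sum.cong refl) (auto simp: sum_distrib_left mult.assoc intro!: sum.cong sum.neutral)
    also have "\<dots> = (f \<otimes>\<^bsub>?A\<^esub> (g \<otimes>\<^bsub>?A\<^esub> h)) x"
      by (rule conv_superset[symmetric]) (use fin supp_conv[where f = g and g = h and G = G] in auto)
    finally show "(f \<otimes>\<^bsub>?A\<^esub> g \<otimes>\<^bsub>?A\<^esub> h) x = (f \<otimes>\<^bsub>?A\<^esub> (g \<otimes>\<^bsub>?A\<^esub> h)) x" .
  qed
  have onec: "\<one>\<^bsub>?A\<^esub> \<in> carrier ?A" unfolding car one by auto
  have lone: "\<one>\<^bsub>?A\<^esub> \<otimes>\<^bsub>?A\<^esub> f = f" if "f \<in> carrier ?A" for f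
  proof
    fix x
    have "(\<one>\<^bsub>?A\<^esub> \<otimes>\<^bsub>?A\<^esub> f) x = (\<Sum>u\<in>{\<one>\<^bsub>G\<^esub>}. \<Sum>v\<in>{x. f x \<noteq> 0}. if u \<otimes>\<^bsub>G\<^esub> v = x then \<one>\<^bsub>?A\<^esub> u * f v else 0)"
      by (rule conv_superset) (use that in \<open>auto simp: car one\<close>)
    also have "\<dots> = (\<Sum>v\<in>{x. f x \<noteq> 0}. if v = x then f v else 0)"
      using that by (auto simp: car one subset_iff intro!: sum.cong)
    also have "\<dots> = f x" using that by (auto simp: car)
    finally show "(\<one>\<^bsub>?A\<^esub> \<otimes>\<^bsub>?A\<^esub> f) x = f x" .
  qed
  have rone: "f \<otimes>\<^bsub>?A\<^esub> \<one>\<^bsub>?A\<^esub> = f" if "f \<in> carrier ?A" for f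
  proof
    fix x
    have "(f \<otimes>\<^bsub>?A\<^esub> \<one>\<^bsub>?A\<^esub>) x = (\<Sum>u\<in>{x. f x \<noteq> 0}. \<Sum>v\<in>{\<one>\<^bsub>G\<^esub>}. if u \<otimes>\<^bsub>G\<^esub> v = x then f u * \<one>\<^bsub>?A\<^esub> v else 0)"
      by (rule conv_superset) (use that in \<open>auto simp: car one\<close>)
    also have "\<dots> = (\<Sum>v\<in>{x. f x \<noteq> 0}. if v = x then f v else 0)"
      using that by (auto simp: car one subset_iff intro!: sum.cong)
    also have "\<dots> = f x" using that by (auto simp: car)
    finally show "(f \<otimes>\<^bsub>?A\<^esub> \<one>\<^bsub>?A\<^esub>) x = f x" .
  qed
  have ldist: "(f \<oplus>\<^bsub>?A\<^esub> g) \<otimes>\<^bsub>?A\<^esub> h = f \<otimes>\<^bsub>?A\<^esub> h \<oplus>\<^bsub>?A\<^esub> g \<otimes>\<^bsub>?A\<^esub> h"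
    if "f \<in> carrier ?A" "g \<in> carrier ?A" "h \<in> carrier ?A" for f g h
  proof
    fix x
    let ?S = "{x. f x \<noteq> 0} \<union> {x. g x \<noteq> 0}" and ?H = "{x. h x \<noteq> 0}"
    have fin: "finite ?S" "finite ?H" using that by (auto simp: car)
    show "((f \<oplus>\<^bsub>?A\<^esub> g) \<otimes>\<^bsub>?A\<^esub> h) x = (f \<otimes>\<^bsub>?A\<^esub> h \<oplus>\<^bsub>?A\<^esub> g \<otimes>\<^bsub>?A\<^esub> h) x"
      unfolding add
      by (subst (1 2 3) conv_superset[of ?S ?H])
         (use fin in \<open>auto simp: sum.distrib[symmetric] algebra_simps intro!: sum.cong\<close>)
  qed
  have rdist: "h \<otimes>\<^bsub>?A\<^esub> (f \<oplus>\<^bsub>?A\<^esub> g) = h \<otimes>\<^bsub>?A\<^esub> f \<oplus>\<^bsub>?A\<^esub> h \<otimes>\<^bsub>?A\<^esub> g"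
    if "f \<in> carrier ?A" "g \<in> carrier ?A" "h \<in> carrier ?A" for f g h
  proof
    fix x
    let ?S = "{x. f x \<noteq> 0} \<union> {x. g x \<noteq> 0}" and ?H = "{x. h x \<noteq> 0}"
    have fin: "finite ?S" "finite ?H" using that by (auto simp: car)
    show "(h \<otimes>\<^bsub>?A\<^esub> (f \<oplus>\<^bsub>?A\<^esub> g)) x = (h \<otimes>\<^bsub>?A\<^esub> f \<oplus>\<^bsub>?A\<^esub> h \<otimes>\<^bsub>?A\<^esub> g) x"
      unfolding add
      by (subst (1 2 3) conv_superset[of ?H ?S])
         (use fin in \<open>auto simp: sum.distrib[symmetric] algebra_simps intro!: sum.cong\<close>)
  qed
  show ?thesis
  proof (rule ringI)
    show "abelian_group ?A"
    proof (rule abelian_groupI)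
      show "\<exists>y\<in>carrier ?A. y \<oplus>\<^bsub>?A\<^esub> x = \<zero>\<^bsub>?A\<^esub>" if "x \<in> carrier ?A" for x
        by (rule bexI[of _ "\<lambda>a. - x a"]) (use that in \<open>auto simp: monoid_algebra_def\<close>)
    qed (use addc in \<open>auto simp: monoid_algebra_def algebra_simps\<close>)
    show "monoid ?A" by (rule monoidI) (use mulc onec assoc lone rone in auto)
  qed (use ldist rdist in auto)
qed

lemma finite_submultisets: "finite {k. k \<subseteq># m}"
proof (induction m)
  case (add a m)
  have "k \<in> {k. k \<subseteq># m} \<union> add_mset a ` {k. k \<subseteq># m}" if "k \<subseteq># add_mset a m" for k
  proof (cases "a \<in># k")
    case True
    then have "k = add_mset a (k - {#a#})" "k - {#a#} \<subseteq># m"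
      using that by (simp_all add: insert_DiffM subset_eq_diff_conv)
    then show ?thesis by blast
  next
    case False
    then have "k \<subseteq># m" using that by (metis diff_single_trivial subset_eq_diff_conv add_mset_add_single)
    then show ?thesis by blast
  qed
  then have "{k. k \<subseteq># add_mset a m} \<subseteq> {k. k \<subseteq># m} \<union> add_mset a ` {k. k \<subseteq># m}" by blast
  then show ?case using add.IH by (meson finite_UnI finite_imageI finite_subset)
qed simp

lemma cring_pow_series: "cring (pow_series I)"
proof -
  let ?P = "pow_series I"
  have fin: "finite {k. k \<subseteq># m}" for m :: "'a multiset"
    by (rule finite_submultisets)
  have dd: "m - (m - k) = k" if "k \<subseteq># m" for m k :: "'a multiset"
    using that by (auto simp: multiset_eq_iff subseteq_mset_def)
  have comm: "f \<otimes>\<^bsub>?P\<^esub> g = g \<otimes>\<^bsub>?P\<^esub> f" for f g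
  proof
    fix m
    have "(\<Sum>k | k \<subseteq># m. f k * g (m - k)) = (\<Sum>k | k \<subseteq># m. g k * f (m - k))"
      by (rule sum.reindex_bij_witness[of _ "\<lambda>k. m - k" "\<lambda>k. m - k"])
         (auto simp: mult.commute dd)
    then show "(f \<otimes>\<^bsub>?P\<^esub> g) m = (g \<otimes>\<^bsub>?P\<^esub> f) m" by (simp add: pow_series_def)
  qed
  have mulc: "f \<otimes>\<^bsub>?P\<^esub> g \<in> carrier ?P" if "f \<in> carrier ?P" "g \<in> carrier ?P" for f g
  proof -
    { fix m assume "(\<Sum>k | k \<subseteq># m. f k * g (m - k)) \<noteq> 0"
      then obtain k where "k \<subseteq># m" "f k * g (m - k) \<noteq> 0"
        by (metis (mono_tags, lifting) mem_Collect_eq sum.not_neutral_contains_not_neutral)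
      then have "set_mset k \<subseteq> I" "set_mset (m - k) \<subseteq> I" "m = k + (m - k)" using that by (auto simp: pow_series_def)
      then have "set_mset m \<subseteq> I" by (metis Un_least set_mset_union) }
    then show ?thesis by (auto simp: pow_series_def)
  qed
  have assoc: "f \<otimes>\<^bsub>?P\<^esub> g \<otimes>\<^bsub>?P\<^esub> h = f \<otimes>\<^bsub>?P\<^esub> (g \<otimes>\<^bsub>?P\<^esub> h)" for f g h
  proof
    fix m
    have "(\<Sum>k | k \<subseteq># m. \<Sum>l | l \<subseteq># k. f l * g (k - l) * h (m - k))
       = (\<Sum>k | k \<subseteq># m. \<Sum>l | l \<subseteq># m - k. f k * (g l * h (m - k - l)))"
    proof -
      have 1: "(\<Sum>k | k \<subseteq># m. \<Sum>l | l \<subseteq># k. f l * g (k - l) * h (m - k))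
        = (\<Sum>(k,l) \<in> Sigma {k. k \<subseteq># m} (\<lambda>k. {l. l \<subseteq># k}). f l * g (k - l) * h (m - k))"
        by (rule sum.Sigma) (auto simp: fin)
      have 2: "(\<Sum>k | k \<subseteq># m. \<Sum>l | l \<subseteq># m - k. f k * (g l * h (m - k - l)))
        = (\<Sum>(k,l) \<in> Sigma {k. k \<subseteq># m} (\<lambda>k. {l. l \<subseteq># m - k}). f k * (g l * h (m - k - l)))"
        by (rule sum.Sigma) (auto simp: fin)
      have t: "l \<subseteq># m" "k - l \<subseteq># m - l" "l + (k - l) = k" "m - l - (k - l) = m - k"
        if "k \<subseteq># m" "l \<subseteq># k" for k l
        using that by (auto simp: subseteq_mset_def multiset_eq_iff diff_le_mono intro: order_trans)
      have t': "k + l \<subseteq># m" if "k \<subseteq># m" "l \<subseteq># m - k" for k l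
        using that by (auto simp: subseteq_mset_def le_diff_conv2 add.commute)
      show ?thesis unfolding 1 2
        by (rule sum.reindex_bij_witness[of _ "\<lambda>(k,l). (k+l, k)" "\<lambda>(k,l). (l, k-l)"])
           (auto simp: t t' mult.assoc)
    qed
    then show "(f \<otimes>\<^bsub>?P\<^esub> g \<otimes>\<^bsub>?P\<^esub> h) m = (f \<otimes>\<^bsub>?P\<^esub> (g \<otimes>\<^bsub>?P\<^esub> h)) m"
      by (simp add: pow_series_def sum_distrib_left sum_distrib_right)
  qed
  have lone: "\<one>\<^bsub>?P\<^esub> \<otimes>\<^bsub>?P\<^esub> f = f" for f
  proof
    fix m
    have "(\<Sum>k | k \<subseteq># m. (if k = {#} then 1 else 0) * f (m - k)) = (\<Sum>k\<in>{{#}}. (if k = {#} then 1 else 0) * f (m - k))"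
      by (rule sum.mono_neutral_right) (auto simp: fin)
    then show "(\<one>\<^bsub>?P\<^esub> \<otimes>\<^bsub>?P\<^esub> f) m = f m" by (simp add: pow_series_def)
  qed
  show ?thesis
  proof (rule cringI)
    show "abelian_group ?P"
    proof (rule abelian_groupI)
      show "\<exists>y\<in>carrier ?P. y \<oplus>\<^bsub>?P\<^esub> x = \<zero>\<^bsub>?P\<^esub>" if "x \<in> carrier ?P" for x
        by (rule bexI[of _ "\<lambda>a. - x a"]) (use that in \<open>auto simp: pow_series_def\<close>)
      show "x \<oplus>\<^bsub>?P\<^esub> y \<in> carrier ?P" if "x \<in> carrier ?P" "y \<in> carrier ?P" for x y
        using that by (simp add: pow_series_def) (metis add.right_neutral)
    qed (auto simp: pow_series_def algebra_simps)
    show "comm_monoid ?P"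
    proof (rule comm_monoidI)
      show "\<one>\<^bsub>?P\<^esub> \<in> carrier ?P" by (simp add: pow_series_def)
    qed (rule mulc assoc lone comm; assumption)+
  qed (auto simp: pow_series_def algebra_simps sum.distrib)
qed

lemma equiv_gen_cong:
  assumes "R \<subseteq> lists X \<times> lists X"
  shows "equiv (lists X) (gen_cong X R)"
proof (rule equivI)
  have "u \<in> lists X \<and> v \<in> lists X" if "(u,v) \<in> gen_cong X R" for u v
    using that by induction (use assms in auto)
  then show "gen_cong X R \<subseteq> lists X \<times> lists X" by auto
  show "refl_on (lists X) (gen_cong X R)"
    by (rule refl_onI) (rule gen_cong.cong_refl)
  show "sym (gen_cong X R)"
    by (rule symI) (rule gen_cong.cong_sym)
  show "trans (gen_cong X R)"
    by (rule transI) (rule gen_cong.cong_trans)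
qed

lemma presented_mult:
  assumes R: "R \<subseteq> lists X \<times> lists X" and "u \<in> lists X" "v \<in> lists X"
  shows "gen_cong X R `` {u} \<otimes>\<^bsub>presented_monoid X R\<^esub> gen_cong X R `` {v} = gen_cong X R `` {u @ v}"
proof -
  note eq = equiv_gen_cong[OF R]
  have class_eq: "gen_cong X R `` {a @ b} = gen_cong X R `` {u @ v}"
    if "(u, a) \<in> gen_cong X R" "(v, b) \<in> gen_cong X R" for a b
    by (rule equiv_class_eq[OF eq]) (rule gen_cong.cong_sym[OF gen_cong.cong_append[OF that]])
  have "(u, u) \<in> gen_cong X R" "(v, v) \<in> gen_cong X R"
    by (rule gen_cong.cong_refl[OF assms(2)], rule gen_cong.cong_refl[OF assms(3)])
  then have "(\<Union>a\<in>gen_cong X R `` {u}. \<Union>b\<in>gen_cong X R `` {v}. gen_cong X R `` {a @ b})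
      = gen_cong X R `` {u @ v}"
    using class_eq by blast
  then show ?thesis by (simp add: presented_monoid_def)
qed

lemma monoid_presented_monoid:
  assumes R: "R \<subseteq> lists X \<times> lists X"
  shows "monoid (presented_monoid X R)"
proof -
  let ?M = "presented_monoid X R"
  have car: "x \<in> carrier ?M \<longleftrightarrow> (\<exists>u\<in>lists X. x = gen_cong X R `` {u})" for x
    by (auto simp: presented_monoid_def quotient_def)
  have one: "\<one>\<^bsub>?M\<^esub> = gen_cong X R `` {[]}" by (simp add: presented_monoid_def)
  show ?thesis
  proof (rule monoidI)
    fix x y assume "x \<in> carrier ?M" "y \<in> carrier ?M"
    then obtain u v where "u \<in> lists X" "v \<in> lists X" "x = gen_cong X R `` {u}" "y = gen_cong X R `` {v}"
      unfolding car by blast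
    then show "x \<otimes>\<^bsub>?M\<^esub> y \<in> carrier ?M"
      unfolding car by (intro bexI[of _ "u @ v"]) (simp_all add: presented_mult[OF R] del: in_lists_conv_set)
    fix z assume "z \<in> carrier ?M"
    then obtain w where "w \<in> lists X" "z = gen_cong X R `` {w}"
      unfolding car by blast
    with \<open>u \<in> lists X\<close> \<open>v \<in> lists X\<close> \<open>x = _\<close> \<open>y = _\<close>
    show "x \<otimes>\<^bsub>?M\<^esub> y \<otimes>\<^bsub>?M\<^esub> z = x \<otimes>\<^bsub>?M\<^esub> (y \<otimes>\<^bsub>?M\<^esub> z)"
      by (simp add: presented_mult[OF R] del: in_lists_conv_set)
  next
    show "\<one>\<^bsub>?M\<^esub> \<in> carrier ?M" unfolding car one by (rule bexI[of _ "[]"]) auto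
    fix x assume "x \<in> carrier ?M"
    then obtain u where "u \<in> lists X" "x = gen_cong X R `` {u}"
      unfolding car by blast
    then show "\<one>\<^bsub>?M\<^esub> \<otimes>\<^bsub>?M\<^esub> x = x" "x \<otimes>\<^bsub>?M\<^esub> \<one>\<^bsub>?M\<^esub> = x"
      by (simp_all add: presented_mult[OF R] one del: in_lists_conv_set)
  qed
qed

lemma group_coxeter_group: "group (coxeter_group I E)"
proof -
  let ?R = "with_cancellation I (coxeter_relations I E)" and ?X = "I \<times> (UNIV :: bool set)"
  have R: "?R \<subseteq> lists ?X \<times> lists ?X"
    by (auto simp: with_cancellation_def coxeter_relations_def)
  let ?M = "presented_monoid ?X ?R"
  interpret M: monoid ?M by (rule monoid_presented_monoid[OF R])
  have car: "x \<in> carrier ?M \<longleftrightarrow> (\<exists>u\<in>lists ?X. x = gen_cong ?X ?R `` {u})" for x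
    by (auto simp: presented_monoid_def quotient_def)
  have inv: "\<exists>v\<in>lists ?X. (v @ u, []) \<in> gen_cong ?X ?R" if "u \<in> lists ?X" for u
    using that
  proof (induction u)
    case Nil
    then show ?case by (intro bexI[of _ "[]"]) (auto intro: gen_cong.cong_refl)
  next
    case (Cons a u)
    obtain x b where a: "a = (x,b)" "x \<in> I" using Cons by (cases a) auto
    obtain v where v: "v \<in> lists ?X" "(v @ u, []) \<in> gen_cong ?X ?R" using Cons by auto
    have "([(x, \<not> b), (x, b)], []) \<in> ?R" unfolding with_cancellation_def using a
      by (cases b) auto
    then have "([(x, \<not> b), (x, b)] @ u, [] @ u) \<in> gen_cong ?X ?R"
      by (intro gen_cong.cong_append gen_cong.cong_base gen_cong.cong_refl) (use Cons in auto)
    then have "(v @ [(x, \<not> b), (x, b)] @ u, v @ [] @ u) \<in> gen_cong ?X ?R"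
      by (intro gen_cong.cong_append[OF gen_cong.cong_refl[OF v(1)]])
    then have "((v @ [(x, \<not> b)]) @ a # u, []) \<in> gen_cong ?X ?R"
      using gen_cong.cong_trans[OF _ v(2)] a by simp
    then show ?case by (intro bexI[of _ "v @ [(x, \<not> b)]"]) (use v a in auto)
  qed
  have one: "\<one>\<^bsub>?M\<^esub> = gen_cong ?X ?R `` {[]}" by (simp add: presented_monoid_def)
  have "group ?M"
  proof (rule M.group_l_invI)
    fix x assume "x \<in> carrier ?M"
    then obtain u where u: "u \<in> lists ?X" "x = gen_cong ?X ?R `` {u}" by (auto simp: car)
    then obtain v where v: "v \<in> lists ?X" "(v @ u, []) \<in> gen_cong ?X ?R" using inv by blast
    have "gen_cong ?X ?R `` {v @ u} = gen_cong ?X ?R `` {[]}"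
      by (rule equiv_class_eq[OF equiv_gen_cong[OF R] v(2)])
    then show "\<exists>y\<in>carrier ?M. y \<otimes>\<^bsub>?M\<^esub> x = \<one>\<^bsub>?M\<^esub>"
      using u v by (intro bexI[of _ "gen_cong ?X ?R `` {v}"]) (auto simp: car one presented_mult[OF R])
  qed
  then show ?thesis by (simp add: coxeter_group_def presented_group_def)
qed

end

theory Submission
  imports Defs
begin

text \<open>
  A word is \<^emph>\<open>reduced\<close> if it is not equivalent, up to commutation of non-adjacent letters, to a
  word containing a square. Left multiplication by \<open>s\<^sub>i\<close> acts on classes of reduced words by
  removing an initial \<open>i\<close> or prepending \<open>i\<close>; hence classes of reduced words are the elements of
  $W_{\mathcal{G}}$. In $\mathbf{U}_{\mathcal{G}}$ the non-reduced words vanish, and multiplying a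
  word by the parity of its inversions makes it invariant under commutations. The linear map sending
  a reduced word \<open>u\<close> to the group element it represents, times the inversion signs of \<open>u\<close> and of
  the lexicographically largest word equivalent to \<open>u\<close>, therefore descends to
  $\mathbf{U}_{\mathcal{G}}$, and it is inverted by choosing largest words.

  For the series, pairs of a class of reduced words and a multiset with independent support are
  matched by a sign-reversing involution which transfers one letter between the two components.
\<close>

section \<open>Words up to commutation\<close>

text \<open>The map cannot respect products, since e_i^2 = 0 while s_i^2 = 1, so it has to be
  defined linearly on the free algebra and checked against the ideal \<open>J\<close>. Elements of
  \<open>J\<close> have no convenient form; well-definedness is therefore proved dually. Functionals
  on words that vanish on every relator in every context have a two-sided ideal as common
  annihilator, and \<open>J\<close> lies in it because it is generated by the relators. The sign of
  the largest word is a normalisation: it is constant on a class and makes the coefficient of the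
  largest word equal to 1, as the prescribed values demand. Conversely, every element is congruent
  modulo \<open>J\<close> to the combination of largest words read off from its image, so
  \<open>J\<close> is the whole kernel. Linear independence of the e_w is thus a consequence and not
  an input. The action on classes also solves the word problem of the group: it identifies
  expressions of minimal length with reduced words, on which the grading and the series
  rest.\<close>

declare in_listsI [rule del] in_listsD [rule del]

text \<open>The congruence is the equivalence generated by single replacements inside a word. With
  this form of induction an invariant need only be tested on one replacement in a fixed context,
  instead of being compatible with the concatenation of two equivalences.\<close>

lemma gen_cong_context_induct [consumes 2, case_names base refl sym trans]:
  assumes "(u, v) \<in> gen_cong X R" and "R \<subseteq> lists X \<times> lists X"
    and base: "\<And>x y s t. \<lbrakk>x \<in> lists X; y \<in> lists X; (s, t) \<in> R\<rbrakk> \<Longrightarrow> P (x @ s @ y) (x @ t @ y)"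
    and refl: "\<And>u. u \<in> lists X \<Longrightarrow> P u u"
    and sym: "\<And>u v. P u v \<Longrightarrow> P v u"
    and trans: "\<And>u v w. P u v \<Longrightarrow> P v w \<Longrightarrow> P u w"
  shows "P u v"
proof -
  have in_lists: "s \<in> lists X \<and> t \<in> lists X" if "(s, t) \<in> gen_cong X R" for s t
    using equiv_type[OF equiv_gen_cong[OF assms(2)]] that by blast
  from assms(1) have "\<forall>x\<in>lists X. \<forall>y\<in>lists X. P (x @ u @ y) (x @ v @ y)"
  proof induction
    case (cong_append u v u' v')
    show ?case
    proof (intro ballI)
      fix x y assume xy: "x \<in> lists X" "y \<in> lists X"
      have l: "u' \<in> lists X" "v \<in> lists X" using cong_append in_lists by blast+
      \<comment> \<open>The two factors are replaced one after the other, the factor at rest being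
        absorbed into the context.\<close>
      have "P (x @ u @ (u' @ y)) (x @ v @ (u' @ y))"
        using cong_append.IH(1) xy l by simp
      moreover have "P ((x @ v) @ u' @ y) ((x @ v) @ v' @ y)"
        using cong_append.IH(2) xy l by (metis append_in_lists_conv)
      ultimately show "P (x @ (u @ u') @ y) (x @ (v @ v') @ y)"
        using trans[of "x @ u @ u' @ y" "x @ v @ u' @ y"] by simp
    qed
  next
    case (cong_refl u)
    then show ?case by (auto intro!: refl)
  next
    case (cong_trans u v w)
    show ?case
    proof (intro ballI)
      fix x y assume "x \<in> lists X" "y \<in> lists X"
      then show "P (x @ u @ y) (x @ w @ y)"
        using cong_trans.IH by (rule_tac trans[of "x @ u @ y" "x @ v @ y"]) auto
    qed
  next
    case (cong_sym u v)
    show ?case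
    proof (intro ballI)
      fix x y assume "x \<in> lists X" "y \<in> lists X"
      then show "P (x @ v @ y) (x @ u @ y)"
        using cong_sym.IH by (rule_tac sym[of "x @ u @ y"]) auto
    qed
  qed (simp add: base)
  then have "P ([] @ u @ []) ([] @ v @ [])" by blast
  then show ?thesis by simp
qed

section \<open>Initial letters, reduced words and inversion signs\<close>

fun initial :: "('i \<times> 'i) set \<Rightarrow> 'i \<Rightarrow> 'i list \<Rightarrow> bool" where
  "initial E i [] \<longleftrightarrow> False"
| "initial E i (a # u) \<longleftrightarrow> a = i \<or> ((a, i) \<notin> E \<and> initial E i u)"

text \<open>Only suffixes of the given word are tested. That the outcome depends on the commutation
  class alone is \<open>reduced_word_pc\<close>.\<close>

fun reduced_word :: "('i \<times> 'i) set \<Rightarrow> 'i list \<Rightarrow> bool" where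
  "reduced_word E [] \<longleftrightarrow> True"
| "reduced_word E (a # u) \<longleftrightarrow> \<not> initial E a u \<and> reduced_word E u"

text \<open>When \<open>initial E i u\<close> holds, the first \<open>i\<close> in \<open>u\<close>
  is preceded only by letters not adjacent to it, so \<open>remove1\<close> deletes exactly an
  occurrence that can be commuted to the front.\<close>

definition left_mult :: "('i \<times> 'i) set \<Rightarrow> 'i \<Rightarrow> 'i list \<Rightarrow> 'i list" where
  "left_mult E i u = (if initial E i u then remove1 i u else i # u)"

definition reduce :: "('i \<times> 'i) set \<Rightarrow> 'i list \<Rightarrow> 'i list" where
  "reduce E u = foldr (left_mult E) u []"

text \<open>A pair of positions counts as an inversion when its letters increase strictly, in
  keeping with the largest word as preferred representative. Equal letters never count.\<close>

fun inv_sign :: "('i \<times> 'i) set \<Rightarrow> 'i list \<Rightarrow> complex" where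
  "inv_sign r [] = 1"
| "inv_sign r (a # u) = (- 1) ^ size {#b \<in># mset u. (a, b) \<in> r - Id#} * inv_sign r u"

lemma initial_in_set: "initial E i u \<Longrightarrow> i \<in> set u"
  by (induction u) auto

lemma reduced_word_suffix: "reduced_word E (x @ y) \<Longrightarrow> reduced_word E y"
  by (induction x) auto

lemma not_reduced_word_square: "\<not> reduced_word E (x @ [a, a] @ y)"
  by (auto dest: reduced_word_suffix)

lemma not_reduced_word_split:
  "\<not> reduced_word E u \<Longrightarrow> \<exists>x a y. u = x @ a # y \<and> initial E a y"
  by (induction u) (auto, metis append_Cons append_Nil, metis append_Cons)

lemma length_left_mult: "length (left_mult E i u) \<le> Suc (length u)"
  by (auto simp: left_mult_def length_remove1)

lemma length_reduce: "length (reduce E u) \<le> length u"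
  by (induction u) (auto simp: reduce_def intro: order_trans[OF length_left_mult])

lemma reduce_reduced: "reduced_word E u \<Longrightarrow> reduce E u = u"
  by (induction u) (auto simp: reduce_def left_mult_def)

text \<open>At the shortest non-reduced suffix the new letter cancels instead of being prepended.
  Every further letter adds at most one to the length, so the loss is never made up.\<close>

lemma length_reduce_less: "\<not> reduced_word E u \<Longrightarrow> length (reduce E u) < length u"
proof (induction u)
  case (Cons a u)
  have eq: "reduce E (a # u) = left_mult E a (reduce E u)" by (simp add: reduce_def)
  show ?case
  proof (cases "reduced_word E u")
    case True
    then have "initial E a u" using Cons by simp
    then show ?thesis using True initial_in_set[of E a u]
      by (auto simp: eq reduce_reduced left_mult_def length_remove1)
  next
    case False
    then show ?thesis using Cons.IH length_left_mult[of E a "reduce E u"] by (simp add: eq)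
  qed
qed simp

lemma inv_sign_square: "inv_sign r u * inv_sign r u = 1"
  by (induction u) (auto simp: power_mult_distrib[symmetric] mult.commute mult.left_commute)

lemma lexord_total_on_lists:
  assumes "total_on X s" "u \<in> lists X" "v \<in> lists X"
  shows "u = v \<or> (u, v) \<in> lexord s \<or> (v, u) \<in> lexord s"
  using assms(2,3)
proof (induction u arbitrary: v)
  case Nil
  then show ?case by (cases v) auto
next
  case (Cons a u)
  then show ?case using assms(1) by (cases v) (auto simp: total_on_def)
qed

lemma finite_total_has_greatest:
  assumes "finite A" "A \<noteq> {}" "trans s"
    and "\<And>x y. x \<in> A \<Longrightarrow> y \<in> A \<Longrightarrow> x = y \<or> (x, y) \<in> s \<or> (y, x) \<in> s"
  shows "\<exists>v\<in>A. \<forall>u\<in>A. u = v \<or> (u, v) \<in> s"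
  using assms(1,2,4)
proof (induction A rule: finite_ne_induct)
  case (insert x F)
  then obtain v where "v \<in> F" "\<forall>u\<in>F. u = v \<or> (u, v) \<in> s" by blast
  then show ?case using insert.prems[of x v] \<open>trans s\<close>
    by (metis insertCI insertE transD)
qed auto

lemma basis_elt_mult:
  "basis_elt u \<otimes>\<^bsub>monoid_algebra G\<^esub> basis_elt v = basis_elt (u \<otimes>\<^bsub>G\<^esub> v)"
proof
  fix x
  show "(basis_elt u \<otimes>\<^bsub>monoid_algebra G\<^esub> basis_elt v) x = basis_elt (u \<otimes>\<^bsub>G\<^esub> v) x"
    by (subst conv_superset[of "{u}" "{v}"]) (auto simp: basis_elt_def)
qed

section \<open>Commutation classes of words\<close>

locale odd_graph =
  fixes I :: "'i set" and E r :: "('i \<times> 'i) set"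
  assumes sym_E: "sym E" and irrefl_E: "irrefl E" and order_r: "linear_order_on I r"
begin

abbreviation equivalent :: "'i list \<Rightarrow> 'i list \<Rightarrow> bool" (infix "\<approx>" 50) where
  "u \<approx> v \<equiv> (u, v) \<in> gen_cong I (commutations I E)"

lemma E_commute: "(a, b) \<in> E \<longleftrightarrow> (b, a) \<in> E"
  using sym_E by (auto dest: symD)

lemma E_irrefl [simp]: "(a, a) \<notin> E"
  using irrefl_E by (simp add: irrefl_def)

lemma commutations_in_lists: "commutations I E \<subseteq> lists I \<times> lists I"
  by (auto simp: commutations_def)

lemmas equiv_pc = equiv_gen_cong[OF commutations_in_lists]

lemma pc_in_lists: "u \<approx> v \<Longrightarrow> u \<in> lists I" "u \<approx> v \<Longrightarrow> v \<in> lists I"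
  using equiv_type[OF equiv_pc] by blast+

lemma pc_induct [consumes 1, case_names swap refl sym trans]:
  assumes "u \<approx> v"
    and "\<And>x y a b. \<lbrakk>x \<in> lists I; y \<in> lists I; a \<in> I; b \<in> I; (a, b) \<notin> E\<rbrakk>
           \<Longrightarrow> P (x @ [a, b] @ y) (x @ [b, a] @ y)"
    and "\<And>u. u \<in> lists I \<Longrightarrow> P u u"
    and "\<And>u v. P u v \<Longrightarrow> P v u"
    and "\<And>u v w. P u v \<Longrightarrow> P v w \<Longrightarrow> P u w"
  shows "P u v"
  using assms(1) commutations_in_lists
proof (induction rule: gen_cong_context_induct)
  case (base x y s t)
  then obtain a b where "s = [a, b]" "t = [b, a]" "a \<in> I" "b \<in> I" "(a, b) \<notin> E"
    by (auto simp: commutations_def)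
  then show ?case using base assms(2) by simp
qed (fact assms)+

lemma pc_refl: "u \<in> lists I \<Longrightarrow> u \<approx> u"
  by (rule gen_cong.cong_refl)

lemma pc_sym: "u \<approx> v \<Longrightarrow> v \<approx> u"
  by (rule gen_cong.cong_sym)

lemma pc_trans [trans]: "u \<approx> v \<Longrightarrow> v \<approx> w \<Longrightarrow> u \<approx> w"
  by (rule gen_cong.cong_trans)

lemma pc_append: "u \<approx> v \<Longrightarrow> u' \<approx> v' \<Longrightarrow> u @ u' \<approx> v @ v'"
  by (rule gen_cong.cong_append)

lemma pc_Cons: "a \<in> I \<Longrightarrow> u \<approx> v \<Longrightarrow> a # u \<approx> a # v"
  using pc_append[of "[a]" "[a]" u v] pc_refl[of "[a]"] by simp

lemma pc_swap:
  assumes "a \<in> I" "b \<in> I" "(a, b) \<notin> E" "x \<in> lists I" "y \<in> lists I"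
  shows "x @ [a, b] @ y \<approx> x @ [b, a] @ y"
proof -
  have "[a, b] \<approx> [b, a]"
    by (rule gen_cong.cong_base) (use assms in \<open>auto simp: commutations_def\<close>)
  then show ?thesis using assms by (intro pc_append pc_refl)
qed

lemma pc_mset: "u \<approx> v \<Longrightarrow> mset u = mset v"
  by (induction rule: pc_induct) auto

lemma pc_length: "u \<approx> v \<Longrightarrow> length u = length v"
  by (metis pc_mset size_mset)

lemma initial_swap:
  "(a, b) \<notin> E \<Longrightarrow> initial E i (x @ [a, b] @ y) \<longleftrightarrow> initial E i (x @ [b, a] @ y)"
  by (induction x) (auto simp: E_commute)

lemma initial_pc: "u \<approx> v \<Longrightarrow> initial E i u \<longleftrightarrow> initial E i v"
proof (induction rule: pc_induct)
  case (swap x y a b)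
  then show ?case by (rule_tac initial_swap)
qed auto

lemma remove1_in_lists: "u \<in> lists I \<Longrightarrow> remove1 i u \<in> lists I"
  using set_remove1_subset[of i u] by (auto simp: lists_eq_set)

lemma remove1_pc: "u \<approx> v \<Longrightarrow> remove1 i u \<approx> remove1 i v"
proof (induction rule: pc_induct)
  case (swap x y a b)
  show ?case
  \<comment> \<open>If the deleted letter lies in \<open>x\<close> or \<open>y\<close>, or does not
    occur, the swap survives the deletion. Otherwise one of the two swapped letters goes, and both
    sides become the same word.\<close>
  proof (cases "i \<in> set x \<or> (i \<noteq> a \<and> i \<noteq> b)")
    case True
    then show ?thesis
      using swap pc_swap[of a b "remove1 i x" y] pc_swap[of a b x "remove1 i y"]
      by (auto simp: remove1_append remove1_in_lists)
  next
    case False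
    then have "remove1 i (x @ [a, b] @ y) = remove1 i (x @ [b, a] @ y)"
      by (auto simp: remove1_append)
    moreover have "remove1 i (x @ [b, a] @ y) \<in> lists I"
      by (rule remove1_in_lists) (use swap in auto)
    ultimately show ?thesis using pc_refl by metis
  qed
next
  case (refl u)
  then show ?case by (intro pc_refl remove1_in_lists)
next
  case (trans u v w)
  then show ?case by (rule_tac pc_trans)
qed (rule pc_sym)

lemma initial_to_front:
  "initial E i u \<Longrightarrow> u \<in> lists I \<Longrightarrow> u \<approx> i # remove1 i u"
proof (induction u)
  case (Cons a u)
  show ?case
  proof (cases "a = i")
    case True
    then show ?thesis using Cons by (auto intro: pc_refl)
  next
    case False
    then have *: "(a, i) \<notin> E" "initial E i u" "u \<in> lists I" "a \<in> I" using Cons by auto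
    then have "i \<in> I" using initial_in_set in_listsD by metis
    have "a # u \<approx> a # i # remove1 i u" using Cons.IH * by (blast intro: pc_Cons)
    also have "a # i # remove1 i u \<approx> i # a # remove1 i u"
      using pc_swap[of a i "[]" "remove1 i u"] * \<open>i \<in> I\<close> remove1_in_lists[of u i] by auto
    finally show ?thesis using False by simp
  qed
qed simp

lemma reduced_word_swap:
  "(a, b) \<notin> E \<Longrightarrow> reduced_word E (x @ [a, b] @ y) \<longleftrightarrow> reduced_word E (x @ [b, a] @ y)"
proof (induction x)
  case Nil
  then show ?case by (auto simp: E_commute)
next
  case (Cons c x)
  then show ?case using initial_swap[of a b c x y] by simp
qed

lemma reduced_word_pc: "u \<approx> v \<Longrightarrow> reduced_word E u \<longleftrightarrow> reduced_word E v"
proof (induction rule: pc_induct)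
  case (swap x y a b)
  then show ?case by (rule_tac reduced_word_swap)
qed auto

lemma left_mult_in_lists: "i \<in> I \<Longrightarrow> u \<in> lists I \<Longrightarrow> left_mult E i u \<in> lists I"
  by (simp add: left_mult_def remove1_in_lists)

lemma left_mult_pc: "i \<in> I \<Longrightarrow> u \<approx> v \<Longrightarrow> left_mult E i u \<approx> left_mult E i v"
  by (simp add: left_mult_def initial_pc remove1_pc pc_Cons)

lemma left_mult_reduced:
  assumes "u \<in> lists I" "reduced_word E u"
  shows "reduced_word E (left_mult E i u)"
proof (cases "initial E i u")
  case True
  then have "reduced_word E (i # remove1 i u)"
    using assms initial_to_front reduced_word_pc by blast
  then show ?thesis using True by (simp add: left_mult_def)
qed (use assms in \<open>simp add: left_mult_def\<close>)

lemma left_mult_left_mult: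
  assumes "i \<in> I" "u \<in> lists I" "reduced_word E u"
  shows "left_mult E i (left_mult E i u) \<approx> u"
proof (cases "initial E i u")
  case True
  then have *: "u \<approx> i # remove1 i u" using assms initial_to_front by blast
  \<comment> \<open>A second initial \<open>i\<close> would make \<open>i # remove1 i u\<close>
    non-reduced, although it is equivalent to \<open>u\<close>.\<close>
  then have "\<not> initial E i (remove1 i u)" using reduced_word_pc assms by fastforce
  then show ?thesis using True * by (simp add: left_mult_def pc_sym)
qed (use assms in \<open>simp add: left_mult_def pc_refl\<close>)

lemma initial_left_mult:
  assumes "i \<noteq> j" "(i, j) \<notin> E" "u \<in> lists I"
  shows "initial E i (left_mult E j u) \<longleftrightarrow> initial E i u"
proof (cases "initial E j u")
  case True
  then have "initial E i u \<longleftrightarrow> initial E i (j # remove1 j u)"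
    using assms initial_to_front initial_pc by blast
  then show ?thesis using True assms by (auto simp: left_mult_def E_commute)
qed (use assms in \<open>auto simp: left_mult_def E_commute\<close>)

lemma left_mult_commute:
  assumes "i \<in> I" "j \<in> I" "(i, j) \<notin> E" "u \<in> lists I"
  shows "left_mult E i (left_mult E j u) \<approx> left_mult E j (left_mult E i u)"
proof (cases "i = j \<or> initial E i u \<or> initial E j u")
  case True
  \<comment> \<open>As soon as one letter is cancelled, or the letters coincide, the two sides agree
    literally. Only two prepended letters require a commutation.\<close>
  then have "left_mult E i (left_mult E j u) = left_mult E j (left_mult E i u)"
    using initial_left_mult[of i j u] initial_left_mult[of j i u] assms
    by (auto simp: left_mult_def E_commute remove1_commute)
  then show ?thesis using assms by (metis left_mult_in_lists pc_refl)
next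
  case False
  then show ?thesis
    using initial_left_mult[of i j u] initial_left_mult[of j i u] assms
      pc_swap[of i j "[]" u]
    by (auto simp: left_mult_def E_commute)
qed

lemma foldr_left_mult:
  "w \<in> lists I \<Longrightarrow> u \<in> lists I \<Longrightarrow> reduced_word E u \<Longrightarrow>
     foldr (left_mult E) w u \<in> lists I \<and> reduced_word E (foldr (left_mult E) w u)"
  by (induction w) (simp_all add: left_mult_in_lists left_mult_reduced)

lemma foldr_left_mult_pc:
  "w \<in> lists I \<Longrightarrow> u \<approx> v \<Longrightarrow> foldr (left_mult E) w u \<approx> foldr (left_mult E) w v"
  by (induction w) (simp_all add: left_mult_pc)

text \<open>Letters further left see the same multiset to their right before and after the swap. Of
  the two orders of \<open>a\<close> and \<open>b\<close>, exactly one counts, by totality and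
  antisymmetry.\<close>

lemma inv_sign_swap:
  assumes "a \<in> I" "b \<in> I" "a \<noteq> b"
  shows "inv_sign r (x @ [a, b] @ y) = - inv_sign r (x @ [b, a] @ y)"
proof (induction x)
  case Nil
  have "(a, b) \<in> r \<longleftrightarrow> (b, a) \<notin> r"
    using order_r assms
    by (auto simp: linear_order_on_def partial_order_on_def total_on_def antisym_def)
  then show ?case using assms by (auto simp: algebra_simps)
next
  case (Cons c x)
  have "mset (x @ [a, b] @ y) = mset (x @ [b, a] @ y)" by simp
  then show ?case using Cons by (simp only: append_Cons inv_sign.simps) simp
qed

section \<open>The largest word of a class\<close>

definition nf :: "'i list \<Rightarrow> 'i list" where
  "nf u = max_word r (pc_class I E u)"

lemma pc_class_eq_iff:
  "u \<in> lists I \<Longrightarrow> v \<in> lists I \<Longrightarrow> pc_class I E u = pc_class I E v \<longleftrightarrow> u \<approx> v"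
  unfolding pc_class_def using eq_equiv_class_iff[OF equiv_pc] by blast

text \<open>This gives meaning to the definite description in \<open>max_word\<close>: a class is
  finite, since equivalent words are rearrangements of each other, and the lexicographic order is
  total on it.\<close>

lemma nf_pc:
  assumes "u \<in> lists I"
  shows "u \<approx> nf u"
proof -
  let ?c = "pc_class I E u" and ?s = "lexord (r - Id)"
  have c: "v \<in> ?c \<longleftrightarrow> u \<approx> v" for v by (simp add: pc_class_def)
  have "?c \<subseteq> {v. set v \<subseteq> set u \<and> length v = length u}"
    using c pc_mset pc_length by (auto dest!: mset_eq_setD)
  then have fin: "finite ?c" by (rule finite_subset) (simp add: finite_lists_length_eq)
  have ne: "?c \<noteq> {}" using c pc_refl[OF assms] by blast
  have rprops: "trans r" "antisym r" "total_on I r"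
    using order_r by (auto simp: linear_order_on_def partial_order_on_def preorder_on_def)
  have tr: "trans ?s" by (intro lexord_transI trans_diff_Id rprops)
  have irr: "(v, v) \<notin> ?s" for v by (rule lexord_irreflexive) simp
  have "\<exists>v\<in>?c. \<forall>w\<in>?c. w = v \<or> (w, v) \<in> ?s"
    using fin ne tr
  proof (rule finite_total_has_greatest)
    fix x y assume "x \<in> ?c" "y \<in> ?c"
    then show "x = y \<or> (x, y) \<in> ?s \<or> (y, x) \<in> ?s"
      using c pc_in_lists rprops(3) by (intro lexord_total_on_lists[of I]) auto
  qed
  then obtain v where v: "v \<in> ?c" "\<forall>w\<in>?c. w = v \<or> (w, v) \<in> ?s" by blast
  have "max_word r ?c = v"
    unfolding max_word_def
  proof (rule the_equality)
    fix w assume w: "w \<in> ?c \<and> (\<forall>u\<in>?c. u = w \<or> (u, w) \<in> ?s)"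
    show "w = v"
    proof (rule ccontr)
      assume "w \<noteq> v"
      then have "(w, v) \<in> ?s" "(v, w) \<in> ?s" using v w by metis+
      then show False using tr irr by (metis transD)
    qed
  qed (use v in blast)
  then show ?thesis using v c by (simp add: nf_def)
qed

lemma nf_in_lists: "u \<in> lists I \<Longrightarrow> nf u \<in> lists I"
  using nf_pc pc_in_lists by blast

lemma nf_eq: "u \<approx> v \<Longrightarrow> nf u = nf v"
  unfolding nf_def using pc_class_eq_iff pc_in_lists by metis

lemma nf_nf [simp]: "u \<in> lists I \<Longrightarrow> nf (nf u) = nf u"
  using nf_pc nf_eq by metis

text \<open>If a representative were not reduced, some suffix \<open>a # y\<close> would have
  \<open>a\<close> initial in \<open>y\<close> and so be equivalent to a word beginning with
  \<open>a\<close> twice, against the bound on \<open>init_mult\<close> for suffixes.\<close>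

lemma pc_monoid'_max_word:
  assumes "c \<in> pc_monoid' I E"
  shows "max_word r c \<in> lists I" "reduced_word E (max_word r c)" "nf (max_word r c) = max_word r c"
proof -
  obtain w where w: "w \<in> lists I" "c = pc_class I E w"
    using assms by (auto simp: pc_monoid'_def pc_monoid_def presented_monoid_def pc_class_def
        quotient_def)
  have max: "max_word r c = nf w" using w by (simp add: nf_def)
  show "max_word r c \<in> lists I" "nf (max_word r c) = max_word r c"
    using max w nf_in_lists by auto
  have "reduced_word E w"
  proof (rule ccontr)
    assume "\<not> reduced_word E w"
    then obtain x a y where xy: "w = x @ a # y" "initial E a y"
      using not_reduced_word_split by blast
    have l: "x \<in> lists I" "a # y \<in> lists I" "a \<in> I" "y \<in> lists I" using xy w by auto
    let ?Q = "\<lambda>k. \<exists>u \<in> lists I. pc_class I E (a # y) = pc_class I E (replicate k a @ u)"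
    have "a # y \<approx> replicate 2 a @ remove1 a y"
      using pc_Cons[OF l(3) initial_to_front[OF xy(2) l(4)]] by (simp add: numeral_2_eq_2)
    then have "pc_class I E (a # y) = pc_class I E (replicate 2 a @ remove1 a y)"
      by (rule pc_class_eq_iff[THEN iffD2, rotated 2])
        (use l in \<open>simp_all add: remove1_in_lists numeral_2_eq_2\<close>)
    then have "?Q 2" using remove1_in_lists[OF l(4)] by (rule_tac bexI)
    \<comment> \<open>Without an upper bound on the admissible exponents, \<open>GREATEST\<close>
      would carry no information.\<close>
    moreover have "k \<le> length (a # y)" if Qk: "?Q k" for k
    proof -
      obtain u where u: "u \<in> lists I" "pc_class I E (a # y) = pc_class I E (replicate k a @ u)"
        using Qk by blast
      moreover have "replicate k a @ u \<in> lists I" using u l by (auto intro: in_listsI)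
      ultimately have "a # y \<approx> replicate k a @ u" using pc_class_eq_iff[OF l(2)] by blast
      then show ?thesis using pc_length by fastforce
    qed
    ultimately have "2 \<le> init_mult I E a (a # y)"
      unfolding init_mult_def by (rule Greatest_le_nat) blast
    moreover have "init_mult I E a (a # y) \<le> 1"
      using assms w l xy by (auto simp: pc_monoid'_def)
    ultimately show False by simp
  qed
  then show "reduced_word E (max_word r c)" using max reduced_word_pc[OF nf_pc[OF w(1)]] by simp
qed


section \<open>Elements of the Coxeter group\<close>

abbreviation cox_cong :: "(('i \<times> bool) list \<times> ('i \<times> bool) list) set" where
  "cox_cong \<equiv> gen_cong (I \<times> UNIV) (with_cancellation I (coxeter_relations I E))"

definition cox :: "'i list \<Rightarrow> ('i \<times> bool) list set" where
  "cox u = cox_cong `` {map (\<lambda>i. (i, True)) u}"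

lemma cox_relations_in_lists:
  "with_cancellation I (coxeter_relations I E) \<subseteq> lists (I \<times> UNIV) \<times> lists (I \<times> UNIV)"
  by (auto simp: with_cancellation_def coxeter_relations_def)

lemmas equiv_cox = equiv_gen_cong[OF cox_relations_in_lists]

lemma map_True_in_lists: "u \<in> lists I \<Longrightarrow> map (\<lambda>i. (i, True)) u \<in> lists (I \<times> UNIV)"
  by (auto simp: lists_eq_set)

lemma cox_mult:
  "u \<in> lists I \<Longrightarrow> v \<in> lists I \<Longrightarrow> cox u \<otimes>\<^bsub>coxeter_group I E\<^esub> cox v = cox (u @ v)"
  by (simp add: cox_def coxeter_group_def presented_group_def map_True_in_lists
      presented_mult[OF cox_relations_in_lists])

lemma cox_Nil: "cox [] = \<one>\<^bsub>coxeter_group I E\<^esub>"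
  by (simp add: cox_def coxeter_group_def presented_group_def presented_monoid_def)

lemma cox_single: "cox [i] = coxeter_gen I E i"
  by (simp add: cox_def coxeter_gen_def)

lemma cox_in_carrier: "u \<in> lists I \<Longrightarrow> cox u \<in> carrier (coxeter_group I E)"
  by (simp add: cox_def coxeter_group_def presented_group_def presented_monoid_def
      quotientI map_True_in_lists)

lemma list_prod_coxeter_gen:
  "u \<in> lists I \<Longrightarrow> list_prod (coxeter_group I E) (map (coxeter_gen I E) u) = cox u"
proof (induction u)
  case Nil
  then show ?case by (simp add: list_prod_def cox_Nil)
next
  case (Cons a u)
  then show ?case using cox_mult[of "[a]" u] by (simp add: list_prod_def cox_single)
qed

lemma cox_surj:
  assumes "w \<in> carrier (coxeter_group I E)"
  shows "\<exists>u \<in> lists I. w = cox u"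
proof -
  obtain v where v: "v \<in> lists (I \<times> UNIV)" "w = cox_cong `` {v}"
    using assms by (auto simp: coxeter_group_def presented_group_def presented_monoid_def quotient_def)
  have letter: "([(i, b)], [(i, True)]) \<in> cox_cong" if "i \<in> I" for i b
  proof (cases b)
    case True
    then show ?thesis using that by (auto intro: gen_cong.cong_refl)
  next
    case False
    \<comment> \<open>The word s s s^-1 equals s^-1 by the square relation and s by cancellation, so
      formal inverses can be replaced by generators.\<close>
    have 1: "([(i, True), (i, True)] @ [(i, False)], [] @ [(i, False)]) \<in> cox_cong"
      by (intro gen_cong.cong_append gen_cong.cong_base gen_cong.cong_refl)
        (use that in \<open>auto simp: with_cancellation_def coxeter_relations_def\<close>)
    have 2: "([(i, True)] @ [(i, True), (i, \<not> True)], [(i, True)] @ []) \<in> cox_cong"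
      by (intro gen_cong.cong_append gen_cong.cong_refl gen_cong.cong_base)
        (use that in \<open>auto simp: with_cancellation_def\<close>)
    show ?thesis using gen_cong.cong_trans[OF gen_cong.cong_sym[OF 1]] 2 False by simp
  qed
  have "(v, map (\<lambda>i. (i, True)) (map fst v)) \<in> cox_cong"
    using v(1)
  proof (induction v)
    case Nil
    then show ?case by (simp add: gen_cong.cong_refl)
  next
    case (Cons p v)
    then have "([p] @ v, [(fst p, True)] @ map (\<lambda>i. (i, True)) (map fst v)) \<in> cox_cong"
      by (intro gen_cong.cong_append) (use letter in \<open>cases p; auto\<close>)+
    then show ?case by simp
  qed
  then have "w = cox (map fst v)"
    unfolding cox_def v(2) by (rule equiv_class_eq[OF equiv_cox])
  moreover have "map fst v \<in> lists I" using v(1) by (auto simp: lists_eq_set)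
  ultimately show ?thesis by blast
qed

lemma cox_context:
  assumes "(map (\<lambda>i. (i, True)) s, map (\<lambda>i. (i, True)) t)
      \<in> with_cancellation I (coxeter_relations I E)"
    and "x \<in> lists I" "y \<in> lists I"
  shows "cox (x @ s @ y) = cox (x @ t @ y)"
proof -
  have "(map (\<lambda>i. (i, True)) (x @ s @ y), map (\<lambda>i. (i, True)) (x @ t @ y)) \<in> cox_cong"
    unfolding map_append using assms
    by (simp add: gen_cong.cong_append gen_cong.cong_refl gen_cong.cong_base map_True_in_lists)
  then show ?thesis unfolding cox_def by (rule equiv_class_eq[OF equiv_cox])
qed

lemma cox_pc: "u \<approx> v \<Longrightarrow> cox u = cox v"
proof (induction rule: pc_induct)
  case (swap x y a b)
  then show ?case
    by (intro cox_context) (auto simp: with_cancellation_def coxeter_relations_def)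
qed auto

lemma cox_left_mult:
  assumes "i \<in> I" "u \<in> lists I"
  shows "cox (left_mult E i u) = cox (i # u)"
proof (cases "initial E i u")
  case True
  have "cox (i # u) = cox (i # i # remove1 i u)"
    by (intro cox_pc pc_Cons initial_to_front True assms)
  also have "\<dots> = cox (remove1 i u)"
    using cox_context[of "[i, i]" "[]" "[]" "remove1 i u"] assms
    by (auto simp: with_cancellation_def coxeter_relations_def remove1_in_lists)
  finally show ?thesis using True by (simp add: left_mult_def)
qed (simp add: left_mult_def)

lemma reduce_in_lists: "u \<in> lists I \<Longrightarrow> reduce E u \<in> lists I"
  and reduced_word_reduce: "u \<in> lists I \<Longrightarrow> reduced_word E (reduce E u)"
  using foldr_left_mult[of u "[]"] by (auto simp: reduce_def)

lemma cox_reduce: "u \<in> lists I \<Longrightarrow> cox (reduce E u) = cox u"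
proof (induction u)
  case (Cons a u)
  then have "cox (reduce E (a # u)) = cox (a # reduce E u)"
    by (simp add: reduce_def cox_left_mult reduce_in_lists[unfolded reduce_def])
  also have "\<dots> = cox (a # u)"
    using Cons cox_mult[of "[a]" "reduce E u"] cox_mult[of "[a]" u]
    by (simp add: reduce_in_lists)
  finally show ?case .
qed (simp add: reduce_def)

text \<open>The Coxeter group acts on classes of reduced words by \<^const>\<open>left_mult\<close>; acting on the empty
  word recovers the class of a reduced word from the group element.\<close>

lemma cox_cong_act:
  assumes "(p, q) \<in> cox_cong"
  shows "\<forall>u \<in> lists I. reduced_word E u \<longrightarrow>
    foldr (left_mult E) (map fst p) u \<approx> foldr (left_mult E) (map fst q) u"
  using assms cox_relations_in_lists
proof (induction rule: gen_cong_context_induct)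
  case (base x y s t)
  have l: "map fst x \<in> lists I" "map fst y \<in> lists I" using base by (auto simp: lists_eq_set)
  show ?case
  proof (intro ballI impI)
    fix u assume u: "u \<in> lists I" "reduced_word E u"
    let ?z = "foldr (left_mult E) (map fst y) u"
    have z: "?z \<in> lists I" "reduced_word E ?z" using foldr_left_mult[OF l(2) u] by auto
    \<comment> \<open>The right context acts first and leaves a reduced word, on which
      \<open>left_mult\<close> is an involution up to equivalence. A letter and its formal inverse
      may therefore act alike, which is why only \<open>fst\<close> is used.\<close>
    have "foldr (left_mult E) (map fst s) ?z \<approx> foldr (left_mult E) (map fst t) ?z"
      using base(3) z left_mult_left_mult left_mult_commute
      by (auto simp: with_cancellation_def coxeter_relations_def)
    then show "foldr (left_mult E) (map fst (x @ s @ y)) u \<approx> foldr (left_mult E) (map fst (x @ t @ y)) u"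
      using foldr_left_mult_pc[OF l(1)] by simp
  qed
next
  case (refl p)
  then have "map fst p \<in> lists I" by (auto simp: lists_eq_set)
  then show ?case using foldr_left_mult pc_refl by blast
next
  case (sym p q)
  then show ?case using pc_sym by blast
next
  case (trans p q s)
  show ?case
  proof (intro ballI impI)
    fix u assume "u \<in> lists I" "reduced_word E u"
    then show "foldr (left_mult E) (map fst p) u \<approx> foldr (left_mult E) (map fst s) u"
      using trans pc_trans[of _ "foldr (left_mult E) (map fst q) u"] by metis
  qed
qed

lemma cox_eq_imp_pc:
  assumes "u \<in> lists I" "v \<in> lists I" "cox u = cox v"
  shows "reduce E u \<approx> reduce E v"
proof -
  have "(map (\<lambda>i. (i, True)) u, map (\<lambda>i. (i, True)) v) \<in> cox_cong"
    using assms eq_equiv_class_iff[OF equiv_cox map_True_in_lists map_True_in_lists]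
    by (simp add: cox_def)
  from cox_cong_act[OF this, rule_format, of "[]"] show ?thesis
    by (simp add: reduce_def comp_def)
qed

lemma cox_inj:
  "\<lbrakk>u \<in> lists I; v \<in> lists I; reduced_word E u; reduced_word E v; cox u = cox v\<rbrakk> \<Longrightarrow> u \<approx> v"
  using cox_eq_imp_pc[of u v] by (simp add: reduce_reduced)

section \<open>Reduced expressions and normal words\<close>

lemma expression_iff: "expression I E w u \<longleftrightarrow> u \<in> lists I \<and> cox u = w"
  by (auto simp: expression_def list_prod_coxeter_gen)

text \<open>\<open>reduce\<close> keeps the group element and strictly shortens a non-reduced word,
  so minimal length forces reducedness. Conversely, a reduced word is equivalent to
  \<open>reduce E v\<close> for every expression \<open>v\<close> of the same element, hence no
  longer than \<open>v\<close>.\<close>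

lemma reduced_expression_iff:
  "reduced_expression I E w u \<longleftrightarrow> u \<in> lists I \<and> cox u = w \<and> reduced_word E u"
proof (intro iffI conjI)
  assume u: "reduced_expression I E w u"
  then show "u \<in> lists I" "cox u = w"
    by (auto simp: reduced_expression_def expression_iff)
  then have "expression I E w (reduce E u)"
    by (simp add: expression_iff reduce_in_lists cox_reduce)
  then have "length u \<le> length (reduce E u)" using u by (auto simp: reduced_expression_def)
  then show "reduced_word E u" using length_reduce_less[of E u] by fastforce
next
  assume u: "u \<in> lists I \<and> cox u = w \<and> reduced_word E u"
  have "length u \<le> length v" if "v \<in> lists I" "cox v = w" for v
  proof -
    have "u \<approx> reduce E v" using cox_eq_imp_pc[of u v] u that by (simp add: reduce_reduced)
    then show ?thesis using pc_length[of u "reduce E v"] length_reduce[of E v] by simp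
  qed
  then show "reduced_expression I E w u" using u by (auto simp: reduced_expression_def expression_iff)
qed

text \<open>The choice in \<open>coxeter_weight\<close> is harmless: reduced expressions of one
  element are equivalent, hence have the same letters.\<close>

lemma coxeter_weight_cox:
  assumes "u \<in> lists I" "reduced_word E u"
  shows "coxeter_weight I E (cox u) = mset u"
proof -
  have "reduced_expression I E (cox u) (SOME v. reduced_expression I E (cox u) v)"
    by (rule someI[of _ u]) (simp add: reduced_expression_iff assms)
  then have "u \<approx> (SOME v. reduced_expression I E (cox u) v)"
    using assms cox_inj by (simp add: reduced_expression_iff)
  then show ?thesis unfolding coxeter_weight_def using pc_mset by fastforce
qed

definition normal_words :: "'i list set" where
  "normal_words = {u \<in> lists I. reduced_word E u \<and> nf u = u}"

lemma nf_normal: "u \<in> lists I \<Longrightarrow> reduced_word E u \<Longrightarrow> nf u \<in> normal_words"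
  using reduced_word_pc[OF nf_pc, of u] by (simp add: normal_words_def nf_in_lists)

lemma bij_betw_cox: "bij_betw cox normal_words (carrier (coxeter_group I E))"
proof (rule bij_betwI')
  fix u v assume "u \<in> normal_words" "v \<in> normal_words"
  then show "cox u = cox v \<longleftrightarrow> u = v"
    using cox_inj[of u v] nf_eq[of u v] by (auto simp: normal_words_def)
next
  fix u assume "u \<in> normal_words"
  then show "cox u \<in> carrier (coxeter_group I E)" by (simp add: normal_words_def cox_in_carrier)
next
  fix w assume "w \<in> carrier (coxeter_group I E)"
  then obtain u where u: "u \<in> lists I" "w = cox u" using cox_surj by blast
  then have "w = cox (nf (reduce E u))"
    using cox_pc[OF nf_pc[of "reduce E u"]] by (simp add: cox_reduce reduce_in_lists)
  moreover have "nf (reduce E u) \<in> normal_words"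
    using u by (simp add: nf_normal reduce_in_lists reduced_word_reduce)
  ultimately show "\<exists>u\<in>normal_words. w = cox u" by blast
qed


section \<open>The algebra $\mathbf{U}_{\mathcal{G}}$\<close>

abbreviation F :: "(complex, 'i list \<Rightarrow> complex) module" where
  "F \<equiv> free_algebra I"

abbreviation J :: "('i list \<Rightarrow> complex) set" where
  "J \<equiv> U_ideal I E"

section \<open>Functionals on the free algebra\<close>

definition pairing :: "('i list \<Rightarrow> complex) \<Rightarrow> ('i list \<Rightarrow> complex) \<Rightarrow> complex" where
  "pairing f h = (\<Sum>u | f u \<noteq> 0. f u * h u)"

text \<open>This is the condition that the functional given by \<open>h\<close> vanishes on every
  relator multiplied by words from both sides, that is, on elements spanning the ideal.\<close>

definition alternating :: "('i list \<Rightarrow> complex) \<Rightarrow> bool" where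
  "alternating h \<longleftrightarrow>
     (\<forall>x \<in> lists I. \<forall>y \<in> lists I. \<forall>i \<in> I. h (x @ [i, i] @ y) = 0) \<and>
     (\<forall>x \<in> lists I. \<forall>y \<in> lists I. \<forall>i \<in> I. \<forall>j \<in> I. i \<noteq> j \<longrightarrow> (i, j) \<notin> E \<longrightarrow>
        h (x @ [i, j] @ y) + h (x @ [j, i] @ y) = 0)"

lemma F_carrier: "f \<in> carrier F \<longleftrightarrow> finite {u. f u \<noteq> 0} \<and> {u. f u \<noteq> 0} \<subseteq> lists I"
  by (simp add: free_algebra_def monoid_algebra_def free_monoid_def)

lemma F_add: "f \<oplus>\<^bsub>F\<^esub> g = (\<lambda>u. f u + g u)"
  by (simp add: free_algebra_def monoid_algebra_def)

lemma F_zero: "\<zero>\<^bsub>F\<^esub> = (\<lambda>u. 0)"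
  by (simp add: free_algebra_def monoid_algebra_def)

lemma F_smult: "c \<odot>\<^bsub>F\<^esub> f = (\<lambda>u. c * f u)"
  by (simp add: free_algebra_def monoid_algebra_def)

lemma F_one: "\<one>\<^bsub>F\<^esub> = basis_elt []"
  by (simp add: free_algebra_def monoid_algebra_def free_monoid_def basis_elt_def)

lemma basis_in_F: "u \<in> lists I \<Longrightarrow> basis_elt u \<in> carrier F"
  by (auto simp: F_carrier basis_elt_def)

lemma F_basis_mult: "basis_elt u \<otimes>\<^bsub>F\<^esub> basis_elt v = basis_elt (u @ v)"
  by (simp add: free_algebra_def basis_elt_mult) (simp add: free_monoid_def)

lemma ring_F: "ring F"
  unfolding free_algebra_def by (rule ring_monoid_algebra[OF monoid_free_monoid])

sublocale F: ring F
  by (rule ring_F)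

lemma F_minus:
  assumes "f \<in> carrier F" "g \<in> carrier F"
  shows "f \<ominus>\<^bsub>F\<^esub> g = (\<lambda>u. f u - g u)"
proof -
  have "(\<lambda>u. - g u) \<in> carrier F" using assms by (simp add: F_carrier)
  then have "\<ominus>\<^bsub>F\<^esub> g = (\<lambda>u. - g u)"
    using assms by (intro F.minus_equality) (auto simp: F_add F_zero)
  then show ?thesis by (simp add: a_minus_def F_add)
qed

lemma pairing_superset:
  assumes "finite A" "{u. f u \<noteq> 0} \<subseteq> A"
  shows "pairing f h = (\<Sum>u\<in>A. f u * h u)"
  unfolding pairing_def by (rule sum.mono_neutral_left) (use assms in auto)

lemma pairing_add:
  assumes "f \<in> carrier F" "g \<in> carrier F"
  shows "pairing (\<lambda>u. f u + g u) h = pairing f h + pairing g h"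
proof -
  let ?A = "{u. f u \<noteq> 0} \<union> {u. g u \<noteq> 0}"
  have "finite ?A" using assms by (simp add: F_carrier)
  then show ?thesis
    by (subst (1 2 3) pairing_superset[of ?A]) (auto simp: sum.distrib[symmetric] algebra_simps)
qed

lemma pairing_smult: "pairing (\<lambda>u. c * f u) h = c * pairing f h"
  by (cases "c = 0") (auto simp: pairing_def sum_distrib_left mult.assoc)

lemma pairing_basis: "pairing (basis_elt u) h = h u"
  by (subst pairing_superset[of "{u}"]) (auto simp: basis_elt_def)

lemma pairing_mult:
  assumes "f \<in> carrier F" "g \<in> carrier F"
  shows "pairing (f \<otimes>\<^bsub>F\<^esub> g) h = (\<Sum>u | f u \<noteq> 0. \<Sum>v | g v \<noteq> 0. f u * g v * h (u @ v))"
proof -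
  let ?A = "{u. f u \<noteq> 0}" and ?B = "{u. g u \<noteq> 0}"
  let ?P = "(\<lambda>(u, v). u @ v) ` (?A \<times> ?B)"
  have fin: "finite ?A" "finite ?B" "finite ?P" using assms by (auto simp: F_carrier)
  have "{u. (f \<otimes>\<^bsub>F\<^esub> g) u \<noteq> 0} \<subseteq> ?P"
    using supp_conv[where f = f and g = g and G = "free_monoid I"]
    by (simp add: free_algebra_def free_monoid_def)
  then have "pairing (f \<otimes>\<^bsub>F\<^esub> g) h = (\<Sum>p\<in>?P. (f \<otimes>\<^bsub>F\<^esub> g) p * h p)"
    by (rule pairing_superset[OF fin(3)])
  also have "\<dots> = (\<Sum>p\<in>?P. \<Sum>u\<in>?A. \<Sum>v\<in>?B. if u @ v = p then f u * g v * h p else 0)"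
    unfolding free_algebra_def conv_superset[OF fin(1,2) order_refl order_refl]
    by (intro sum.cong refl)
      (auto simp: free_monoid_def sum_distrib_right intro!: sum.cong)
  also have "\<dots> = (\<Sum>u\<in>?A. \<Sum>v\<in>?B. \<Sum>p\<in>?P. if u @ v = p then f u * g v * h p else 0)"
    by (rule sum_rotate3)
  also have "\<dots> = (\<Sum>u\<in>?A. \<Sum>v\<in>?B. f u * g v * h (u @ v))"
    by (intro sum.cong refl) (use fin in \<open>auto simp: sum.delta'\<close>)
  finally show ?thesis .
qed

text \<open>The contexts in \<open>alternating\<close> are arbitrary, so a fixed prefix or suffix is
  absorbed by them.\<close>

lemma alternating_translate:
  assumes "alternating h" "z \<in> lists I"
  shows "alternating (\<lambda>u. h (z @ u))" "alternating (\<lambda>u. h (u @ z))"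
proof -
  have sq: "h (x @ [i, i] @ y) = 0" if "x \<in> lists I" "y \<in> lists I" "i \<in> I" for x y i
    using assms(1) that by (auto simp: alternating_def)
  have sw: "h (x @ [i, j] @ y) + h (x @ [j, i] @ y) = 0"
    if "x \<in> lists I" "y \<in> lists I" "i \<in> I" "j \<in> I" "i \<noteq> j" "(i, j) \<notin> E" for x y i j
    using assms(1) that by (auto simp: alternating_def)
  show "alternating (\<lambda>u. h (z @ u))"
    unfolding alternating_def using sq[of "z @ _"] sw[of "z @ _"] assms(2) by auto
  show "alternating (\<lambda>u. h (u @ z))"
    unfolding alternating_def using sq[of _ "_ @ z"] sw[of _ "_ @ z"] assms(2) by auto
qed

text \<open>Pairing a product with \<open>h\<close> gives a combination of pairings of one factor
  with translates of \<open>h\<close>. Closure of \<open>alternating\<close> under translation on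
  both sides makes the annihilator two-sided.\<close>

lemma ideal_annihilator:
  "ideal {f \<in> carrier F. \<forall>h. alternating h \<longrightarrow> pairing f h = 0} F" (is "ideal ?K F")
proof (rule idealI[OF ring_F])
  show "subgroup ?K (add_monoid F)"
  proof (rule F.add.subgroupI)
    show "?K \<noteq> {}" using F.zero_closed by (auto simp: F_zero pairing_def)
    fix f assume f: "f \<in> ?K"
    have "\<ominus>\<^bsub>F\<^esub> f = (\<lambda>u. 0 - f u)"
      using F_minus[of "\<zero>\<^bsub>F\<^esub>" f] f by (simp add: F_zero[symmetric] F.minus_eq) (simp add: F_zero)
    then have "\<ominus>\<^bsub>F\<^esub> f = (\<lambda>u. (- 1) * f u)" by simp
    then show "\<ominus>\<^bsub>F\<^esub> f \<in> ?K"
      using f F.a_inv_closed[of f] pairing_smult[of "-1" f] by auto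
    fix g assume g: "g \<in> ?K"
    then show "f \<oplus>\<^bsub>F\<^esub> g \<in> ?K" using f F.a_closed[of f g] pairing_add by (auto simp: F_add)
  qed auto
next
  fix f g assume f: "f \<in> ?K" and g: "g \<in> carrier F"
  then have fF: "f \<in> carrier F" and fl: "\<And>v. f v \<noteq> 0 \<Longrightarrow> v \<in> lists I"
    and gl: "\<And>v. g v \<noteq> 0 \<Longrightarrow> v \<in> lists I"
    by (auto simp: F_carrier)
  have "pairing (g \<otimes>\<^bsub>F\<^esub> f) h = 0" if h: "alternating h" for h
  proof -
    have "pairing (g \<otimes>\<^bsub>F\<^esub> f) h = (\<Sum>u | g u \<noteq> 0. g u * pairing f (\<lambda>v. h (u @ v)))"
      unfolding pairing_mult[OF g fF] by (simp add: pairing_def sum_distrib_left mult.assoc)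
    also have "\<dots> = 0"
      using f alternating_translate(1)[OF h gl] by (intro sum.neutral) auto
    finally show ?thesis .
  qed
  then show "g \<otimes>\<^bsub>F\<^esub> f \<in> ?K" using g fF by simp
  have "pairing (f \<otimes>\<^bsub>F\<^esub> g) h = 0" if h: "alternating h" for h
  proof -
    have "pairing (f \<otimes>\<^bsub>F\<^esub> g) h = (\<Sum>v | g v \<noteq> 0. g v * pairing f (\<lambda>u. h (u @ v)))"
      unfolding pairing_mult[OF fF g]
      by (subst sum.swap) (simp add: pairing_def sum_distrib_left mult_ac)
    also have "\<dots> = 0"
      using f alternating_translate(2)[OF h gl] by (intro sum.neutral) auto
    finally show ?thesis .
  qed
  then show "f \<otimes>\<^bsub>F\<^esub> g \<in> ?K" using g fF by simp
qed

lemma U_relators_eq: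
  "U_relators I E = {basis_elt [i, i] | i. i \<in> I} \<union>
     {(\<lambda>u. basis_elt [i, j] u + basis_elt [j, i] u) | i j. i \<in> I \<and> j \<in> I \<and> i \<noteq> j \<and> (i, j) \<notin> E}"
  by (simp add: U_relators_def F_basis_mult F_add)

lemma U_relators_in_F: "U_relators I E \<subseteq> carrier F"
  unfolding U_relators_eq using F.a_closed[OF basis_in_F basis_in_F]
  by (auto simp: basis_in_F F_add)

sublocale J: ideal J F
  unfolding U_ideal_def by (rule F.genideal_ideal[OF U_relators_in_F])

lemma pairing_J: "f \<in> J \<Longrightarrow> alternating h \<Longrightarrow> pairing f h = 0"
proof -
  let ?K = "{f \<in> carrier F. \<forall>h. alternating h \<longrightarrow> pairing f h = 0}"
  have "U_relators I E \<subseteq> ?K"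
  proof
    fix f assume f: "f \<in> U_relators I E"
    then have fF: "f \<in> carrier F" using U_relators_in_F by blast
    have "pairing f h = 0" if "alternating h" for h
    proof -
      have sq: "h ([] @ [i, i] @ []) = 0" if "i \<in> I" for i
        using \<open>alternating h\<close> that unfolding alternating_def by blast
      have sw: "h ([] @ [i, j] @ []) + h ([] @ [j, i] @ []) = 0"
        if "i \<in> I" "j \<in> I" "i \<noteq> j" "(i, j) \<notin> E" for i j
        using \<open>alternating h\<close> that unfolding alternating_def by blast
      show ?thesis
        using f sq sw unfolding U_relators_eq by (auto simp: pairing_add basis_in_F pairing_basis)
    qed
    then show "f \<in> ?K" using fF by simp
  qed
  then have "J \<subseteq> ?K"
    unfolding U_ideal_def by (rule F.genideal_minimal[OF ideal_annihilator])
  then show "f \<in> J \<Longrightarrow> alternating h \<Longrightarrow> pairing f h = 0" by blast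
qed

section \<open>Congruences modulo the ideal\<close>

lemma J_add: "f \<in> J \<Longrightarrow> g \<in> J \<Longrightarrow> (\<lambda>u. f u + g u) \<in> J"
  using J.a_closed[of f g] by (simp add: F_add)

text \<open>\<open>J\<close> is only given as an ideal of a ring. Scalars embedded as multiples of
  the empty word make it a subspace.\<close>

lemma smult_eq_mult:
  assumes "f \<in> carrier F"
  shows "(\<lambda>u. c * f u) = (\<lambda>u. c * basis_elt [] u) \<otimes>\<^bsub>F\<^esub> f"
proof
  fix x
  have "((\<lambda>u. c * basis_elt [] u) \<otimes>\<^bsub>F\<^esub> f) x = (\<Sum>u\<in>{[]}. \<Sum>v | f v \<noteq> 0.
      if u \<otimes>\<^bsub>free_monoid I\<^esub> v = x then (c * basis_elt [] u) * f v else 0)"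
    unfolding free_algebra_def
    by (rule conv_superset) (use assms in \<open>auto simp: F_carrier basis_elt_def\<close>)
  also have "\<dots> = c * f x"
    using assms by (simp add: free_monoid_def basis_elt_def F_carrier sum.delta)
  finally show "c * f x = ((\<lambda>u. c * basis_elt [] u) \<otimes>\<^bsub>F\<^esub> f) x" by simp
qed

lemma smult_in_F: "f \<in> carrier F \<Longrightarrow> (\<lambda>u. c * f u) \<in> carrier F"
  by (cases "c = 0") (auto simp: F_carrier)

lemma J_smult:
  assumes "f \<in> J"
  shows "(\<lambda>u. c * f u) \<in> J"
  using J.I_l_closed[OF assms smult_in_F[OF basis_in_F[of "[]"], of c]]
    smult_eq_mult[of f c] J.a_subset assms by auto

lemma J_basis_square:
  assumes "x \<in> lists I" "y \<in> lists I" "i \<in> I"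
  shows "basis_elt (x @ [i, i] @ y) \<in> J"
proof -
  have "basis_elt [i, i] \<in> J"
    unfolding U_ideal_def using F.genideal_self[OF U_relators_in_F] assms
    by (auto simp: U_relators_eq)
  then have "basis_elt x \<otimes>\<^bsub>F\<^esub> basis_elt [i, i] \<otimes>\<^bsub>F\<^esub> basis_elt y \<in> J"
    by (intro J.I_l_closed J.I_r_closed basis_in_F assms)
  then show ?thesis by (simp add: F_basis_mult)
qed

lemma J_basis_swap:
  assumes "x \<in> lists I" "y \<in> lists I" "i \<in> I" "j \<in> I" "i \<noteq> j" "(i, j) \<notin> E"
  shows "(\<lambda>u. basis_elt (x @ [i, j] @ y) u + basis_elt (x @ [j, i] @ y) u) \<in> J"
proof -
  let ?a = "basis_elt [i, j]" and ?b = "basis_elt [j, i]"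
  have "?a \<oplus>\<^bsub>F\<^esub> ?b \<in> J"
    unfolding U_ideal_def using F.genideal_self[OF U_relators_in_F] assms
    by (auto simp: U_relators_eq F_add)
  then have "basis_elt x \<otimes>\<^bsub>F\<^esub> (?a \<oplus>\<^bsub>F\<^esub> ?b) \<otimes>\<^bsub>F\<^esub> basis_elt y \<in> J"
    by (intro J.I_l_closed J.I_r_closed basis_in_F assms)
  also have "basis_elt x \<otimes>\<^bsub>F\<^esub> (?a \<oplus>\<^bsub>F\<^esub> ?b) \<otimes>\<^bsub>F\<^esub> basis_elt y =
      basis_elt x \<otimes>\<^bsub>F\<^esub> ?a \<otimes>\<^bsub>F\<^esub> basis_elt y \<oplus>\<^bsub>F\<^esub> basis_elt x \<otimes>\<^bsub>F\<^esub> ?b \<otimes>\<^bsub>F\<^esub> basis_elt y"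
    using assms by (simp add: F.r_distr F.l_distr basis_in_F)
  finally show ?thesis by (simp add: F_basis_mult F_add)
qed

text \<open>The sign flips with each exchange of distinct letters, which turns anticommutation
  modulo \<open>J\<close> into invariance.\<close>

lemma J_basis_pc:
  "u \<approx> v \<Longrightarrow> (\<lambda>x. inv_sign r u * basis_elt u x - inv_sign r v * basis_elt v x) \<in> J"
proof (induction rule: pc_induct)
  case (swap x y a b)
  show ?case
  \<comment> \<open>\<open>commutations\<close> also contains the trivial swap of a letter with
    itself, for which no sign changes and the difference is zero.\<close>
  proof (cases "a = b")
    case True
    then show ?thesis using J.zero_closed by (simp add: F_zero)
  next
    case False
    have "(\<lambda>u. inv_sign r (x @ [a, b] @ y) *
        (basis_elt (x @ [a, b] @ y) u + basis_elt (x @ [b, a] @ y) u)) \<in> J"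
      by (rule J_smult[OF J_basis_swap]) (use swap False in auto)
    moreover have "inv_sign r (x @ [b, a] @ y) = - inv_sign r (x @ [a, b] @ y)"
      using inv_sign_swap[of b a x y] False swap by simp
    ultimately show ?thesis by (simp add: algebra_simps)
  qed
next
  case (refl u)
  then show ?case using J.zero_closed by (simp add: F_zero)
next
  case (sym u v)
  from J_smult[OF sym, of "-1"] show ?case by (simp add: algebra_simps)
next
  case (trans u v w)
  from J_add[OF trans] show ?case by simp
qed

text \<open>The repeated letter can be commuted next to its twin, where the relator e_i^2
  applies.\<close>

lemma J_basis_not_reduced:
  assumes "u \<in> lists I" "\<not> reduced_word E u"
  shows "basis_elt u \<in> J"
proof -
  obtain x a y where u: "u = x @ a # y" "initial E a y"
    using not_reduced_word_split[OF assms(2)] by blast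
  then have l: "x \<in> lists I" "a \<in> I" "y \<in> lists I" using assms(1) by auto
  let ?v = "x @ [a, a] @ remove1 a y"
  have "u \<approx> ?v"
    using pc_append[OF pc_refl[OF l(1)] pc_Cons[OF l(2) initial_to_front[OF u(2) l(3)]]] u
    by simp
  then have "(\<lambda>z. inv_sign r u * basis_elt u z - inv_sign r ?v * basis_elt ?v z) \<in> J"
    by (rule J_basis_pc)
  from J_add[OF this J_smult[OF J_basis_square[OF l(1) remove1_in_lists[OF l(3), of a] l(2)],
      of "inv_sign r ?v"]]
  have "(\<lambda>z. inv_sign r u * basis_elt u z) \<in> J" by simp
  from J_smult[OF this, of "inv_sign r u"] show ?thesis
    by (simp add: mult.assoc[symmetric] inv_sign_square)
qed

section \<open>The linear map on the free algebra and its section\<close>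

definition psi_coeff :: "('i \<times> bool) list set \<Rightarrow> 'i list \<Rightarrow> complex" where
  "psi_coeff w u = (if reduced_word E u \<and> cox u = w then inv_sign r u * inv_sign r (nf u) else 0)"

definition psi :: "('i list \<Rightarrow> complex) \<Rightarrow> ('i \<times> bool) list set \<Rightarrow> complex" where
  "psi f = (\<lambda>w. pairing f (psi_coeff w))"

definition sect :: "(('i \<times> bool) list set \<Rightarrow> complex) \<Rightarrow> 'i list \<Rightarrow> complex" where
  "sect g = (\<lambda>u. if u \<in> normal_words then g (cox u) else 0)"

text \<open>Under a swap of commuting distinct letters only the factor \<open>inv_sign r u\<close>
  changes, and it changes sign. The remaining data depend on the class alone, and words containing a
  square have coefficient zero.\<close>

lemma alternating_psi_coeff: "alternating (psi_coeff w)"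
proof -
  have "psi_coeff w (x @ [i, j] @ y) + psi_coeff w (x @ [j, i] @ y) = 0"
    if "x \<in> lists I" "y \<in> lists I" "i \<in> I" "j \<in> I" "i \<noteq> j" "(i, j) \<notin> E" for x y i j
  proof -
    have pc: "x @ [i, j] @ y \<approx> x @ [j, i] @ y" using that by (intro pc_swap)
    show ?thesis
      using reduced_word_pc[OF pc] cox_pc[OF pc] nf_eq[OF pc] inv_sign_swap[of i j x y] that
      by (simp add: psi_coeff_def)
  qed
  moreover have "psi_coeff w (x @ [i, i] @ y) = 0" for x y i
    using not_reduced_word_square[of E x i y] by (simp add: psi_coeff_def)
  ultimately show ?thesis by (simp add: alternating_def)
qed

lemma psi_J: "f \<in> J \<Longrightarrow> psi f = (\<lambda>w. 0)"
  by (simp add: psi_def pairing_J alternating_psi_coeff)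

lemma psi_add:
  "f \<in> carrier F \<Longrightarrow> g \<in> carrier F \<Longrightarrow> psi (\<lambda>u. f u + g u) = (\<lambda>w. psi f w + psi g w)"
  by (simp add: psi_def pairing_add)

lemma psi_smult: "psi (\<lambda>u. c * f u) = (\<lambda>w. c * psi f w)"
  by (simp add: psi_def pairing_smult)

lemma psi_nonzero:
  assumes "f \<in> carrier F" "psi f w \<noteq> 0"
  shows "\<exists>u \<in> lists I. f u \<noteq> 0 \<and> reduced_word E u \<and> cox u = w"
proof -
  obtain u where "u \<in> {u. f u \<noteq> 0}" "f u * psi_coeff w u \<noteq> 0"
    using assms(2) unfolding psi_def pairing_def by (rule sum.not_neutral_contains_not_neutral)
  then show ?thesis using assms(1) by (auto simp: F_carrier psi_coeff_def split: if_splits)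
qed

lemma cox_algebra_carrier:
  "g \<in> carrier (coxeter_algebra I E) \<longleftrightarrow>
     finite {w. g w \<noteq> 0} \<and> {w. g w \<noteq> 0} \<subseteq> carrier (coxeter_group I E)"
  by (simp add: coxeter_algebra_def monoid_algebra_def)

lemma psi_closed:
  assumes "f \<in> carrier F"
  shows "psi f \<in> carrier (coxeter_algebra I E)"
proof -
  have "{w. psi f w \<noteq> 0} \<subseteq> cox ` {u. f u \<noteq> 0}" using psi_nonzero[OF assms] by blast
  moreover have "finite {u. f u \<noteq> 0}" using assms by (simp add: F_carrier)
  moreover have "{w. psi f w \<noteq> 0} \<subseteq> carrier (coxeter_group I E)"
    using psi_nonzero[OF assms] cox_in_carrier by blast
  ultimately show ?thesis unfolding cox_algebra_carrier by (meson finite_imageI finite_subset)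
qed

lemma sect_closed:
  assumes "g \<in> carrier (coxeter_algebra I E)"
  shows "sect g \<in> carrier F"
proof -
  have "inj_on cox {u. sect g u \<noteq> 0}"
    by (rule inj_on_subset[OF bij_betw_imp_inj_on[OF bij_betw_cox]]) (auto simp: sect_def)
  moreover have "cox ` {u. sect g u \<noteq> 0} \<subseteq> {w. g w \<noteq> 0}" by (auto simp: sect_def split: if_splits)
  moreover have "finite {w. g w \<noteq> 0}" using assms by (simp add: cox_algebra_carrier)
  ultimately have "finite {u. sect g u \<noteq> 0}" by (rule inj_on_finite)
  moreover have "{u. sect g u \<noteq> 0} \<subseteq> lists I" by (auto simp: sect_def normal_words_def split: if_splits)
  ultimately show ?thesis by (simp add: F_carrier)
qed

lemma psi_sect:
  assumes "g \<in> carrier (coxeter_algebra I E)"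
  shows "psi (sect g) = g"
proof
  fix w
  show "psi (sect g) w = g w"
  proof (cases "w \<in> carrier (coxeter_group I E)")
    case False
    then have "psi (sect g) w = 0"
      using psi_closed[OF sect_closed[OF assms]] by (auto simp: cox_algebra_carrier)
    moreover have "g w = 0" using False assms by (auto simp: cox_algebra_carrier)
    ultimately show ?thesis by simp
  next
    case True
    then obtain v where v: "v \<in> normal_words" "w = cox v"
      using bij_betw_imp_surj_on[OF bij_betw_cox] by blast
    \<comment> \<open>When \<open>g w = 0\<close>, the word \<open>v\<close> is missing from the
      support, so it is added to have a uniform sum.\<close>
    let ?A = "insert v {u. sect g u \<noteq> 0}"
    have fin: "finite ?A" using sect_closed[OF assms] by (simp add: F_carrier)
    have "psi (sect g) w = (\<Sum>u\<in>?A. sect g u * psi_coeff w u)"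
      unfolding psi_def by (rule pairing_superset[OF fin]) auto
    also have "\<dots> = (\<Sum>u\<in>?A. if u = v then g w else 0)"
    proof (rule sum.cong[OF refl])
      fix u assume "u \<in> ?A"
      then have u: "u \<in> normal_words" using v by (auto simp: sect_def split: if_splits)
      have "cox u = w \<longleftrightarrow> u = v"
        using inj_on_eq_iff[OF bij_betw_imp_inj_on[OF bij_betw_cox] u v(1)] v(2) by simp
      then show "sect g u * psi_coeff w u = (if u = v then g w else 0)"
        using u by (auto simp: sect_def psi_coeff_def normal_words_def inv_sign_square)
    qed
    also have "\<dots> = g w" using fin by (simp add: sum.delta)
    finally show ?thesis .
  qed
qed

text \<open>A non-reduced word is sent to 0 and lies in \<open>J\<close>. A reduced one is sent to
  its group element with the very sign by which it differs from its largest word modulo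
  \<open>J\<close>.\<close>

lemma sect_psi_basis:
  assumes "u \<in> lists I"
  shows "(\<lambda>x. basis_elt u x - sect (psi (basis_elt u)) x) \<in> J"
proof (cases "reduced_word E u")
  case False
  then have "sect (psi (basis_elt u)) = (\<lambda>x. 0)"
    by (auto simp: sect_def psi_def pairing_basis psi_coeff_def)
  then show ?thesis using J_basis_not_reduced[OF assms False] by simp
next
  case True
  have pc: "u \<approx> nf u" by (rule nf_pc[OF assms])
  have n: "nf u \<in> normal_words" by (rule nf_normal[OF assms True])
  have "cox u = cox x \<longleftrightarrow> x = nf u" if "x \<in> normal_words" for x
    using inj_on_eq_iff[OF bij_betw_imp_inj_on[OF bij_betw_cox] that n] cox_pc[OF pc] by auto
  then have "sect (psi (basis_elt u)) = (\<lambda>x. inv_sign r u * inv_sign r (nf u) * basis_elt (nf u) x)"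
    using n True unfolding sect_def psi_def pairing_basis psi_coeff_def
    by (auto simp: basis_elt_def)
  with J_smult[OF J_basis_pc[OF pc], of "inv_sign r u"] show ?thesis
    by (simp add: right_diff_distrib mult.assoc[symmetric] inv_sign_square)
qed

text \<open>The normal words span the quotient. As \<open>sect\<close> and \<open>psi\<close> are
  linear, the case of a single word extends along the support.\<close>

lemma sect_psi:
  assumes "f \<in> carrier F"
  shows "(\<lambda>x. f x - sect (psi f) x) \<in> J"
proof -
  have "(\<lambda>x. f x - sect (psi f) x) \<in> J"
    if "finite A" "A \<subseteq> lists I" "{u. f u \<noteq> 0} \<subseteq> A" for A f
    using that
  proof (induction A arbitrary: f)
    case empty
    then have "f = (\<lambda>x. 0)" by auto
    moreover have "sect (psi (\<lambda>x. 0)) = (\<lambda>x. 0)" by (auto simp: sect_def psi_def pairing_def)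
    ultimately show ?case using J.zero_closed by (simp add: F_zero)
  next
    case (insert u A)
    \<comment> \<open>One word is split off from \<open>f\<close> together with its coefficient. The
      set \<open>A\<close> need only contain the support, so \<open>g\<close> falls under the
      induction hypothesis.\<close>
    define g where "g = f(u := 0)"
    define b where "b = (\<lambda>x. f u * basis_elt u x)"
    have gA: "{x. g x \<noteq> 0} \<subseteq> A" using insert by (auto simp: g_def)
    then have gF: "g \<in> carrier F" using insert finite_subset[OF gA] by (auto simp: F_carrier)
    have bF: "b \<in> carrier F" unfolding b_def using insert by (intro smult_in_F basis_in_F) auto
    have f: "f = (\<lambda>x. g x + b x)" by (auto simp: g_def b_def basis_elt_def)
    have s: "sect (psi f) = (\<lambda>x. sect (psi g) x + f u * sect (psi (basis_elt u)) x)"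
      unfolding f psi_add[OF gF bF] by (auto simp: b_def psi_smult sect_def g_def basis_elt_def)
    have "(\<lambda>x. f u * (basis_elt u x - sect (psi (basis_elt u)) x)) \<in> J"
      using insert by (intro J_smult sect_psi_basis) auto
    moreover have "(\<lambda>x. g x - sect (psi g) x) \<in> J" using insert gA by simp
    ultimately have "(\<lambda>x. (g x - sect (psi g) x) +
        f u * (basis_elt u x - sect (psi (basis_elt u)) x)) \<in> J" by (rule J_add[rotated])
    also have "(\<lambda>x. (g x - sect (psi g) x) + f u * (basis_elt u x - sect (psi (basis_elt u)) x))
        = (\<lambda>x. f x - sect (psi f) x)"
    proof
      fix x
      have "f x = g x + f u * basis_elt u x" by (simp add: g_def basis_elt_def)
      then show "(g x - sect (psi g) x) + f u * (basis_elt u x - sect (psi (basis_elt u)) x) =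
          f x - sect (psi f) x"
        by (simp add: s algebra_simps)
    qed
    finally show ?case .
  qed
  then show ?thesis using assms F_carrier by blast
qed

lemma sect_zero: "sect (\<lambda>w. 0) = (\<lambda>u. 0)"
  by (auto simp: sect_def)

text \<open>The kernel of \<open>psi\<close> is \<open>J\<close>: one inclusion is
  \<open>psi_J\<close>, and an element with zero image is congruent to \<open>sect\<close> of zero
  by \<open>sect_psi\<close>.\<close>

lemma coset_eq_iff:
  assumes "f \<in> carrier F" "g \<in> carrier F"
  shows "J +>\<^bsub>F\<^esub> f = J +>\<^bsub>F\<^esub> g \<longleftrightarrow> psi f = psi g"
proof -
  have d: "(\<lambda>x. f x - g x) \<in> carrier F"
    using F.minus_closed[OF assms] by (simp add: F_minus assms)
  have p: "psi f = (\<lambda>w. psi (\<lambda>x. f x - g x) w + psi g w)"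
    using psi_add[OF d assms(2)] by simp
  have "J +>\<^bsub>F\<^esub> f = J +>\<^bsub>F\<^esub> g \<longleftrightarrow> (\<lambda>x. f x - g x) \<in> J"
    using F.quotient_eq_iff_same_a_r_cos[OF J.is_ideal assms] F_minus[OF assms] by simp
  also have "\<dots> \<longleftrightarrow> psi f = psi g"
  proof
    assume "(\<lambda>x. f x - g x) \<in> J"
    then show "psi f = psi g" using p psi_J by simp
  next
    assume "psi f = psi g"
    then have "psi (\<lambda>x. f x - g x) = (\<lambda>w. 0)" using p by (metis add_cancel_left_left)
    then show "(\<lambda>x. f x - g x) \<in> J" using sect_psi[OF d] by (simp add: sect_zero)
  qed
  finally show ?thesis .
qed

section \<open>The induced isomorphism and the grading\<close>

definition phi :: "('i list \<Rightarrow> complex) set \<Rightarrow> ('i \<times> bool) list set \<Rightarrow> complex" where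
  "phi B = psi (SOME f. f \<in> B)"

text \<open>Any representative yields the same value, because equal cosets have equal images under
  \<open>psi\<close>.\<close>

lemma phi_coset:
  assumes "f \<in> carrier F"
  shows "phi (J +>\<^bsub>F\<^esub> f) = psi f"
proof -
  let ?g = "SOME g. g \<in> J +>\<^bsub>F\<^esub> f"
  have "?g \<in> J +>\<^bsub>F\<^esub> f" by (rule someI[where x = f]) (rule J.a_rcos_self[OF assms])
  then have "J +>\<^bsub>F\<^esub> f = J +>\<^bsub>F\<^esub> ?g" "?g \<in> carrier F"
    using F.a_repr_independence[OF _ assms J.a_subgroup] J.a_elemrcos_carrier[OF assms] by auto
  then show ?thesis unfolding phi_def using coset_eq_iff[OF assms] by metis
qed

lemma U_carrier: "carrier (U_algebra I E) = (\<lambda>f. J +>\<^bsub>F\<^esub> f) ` carrier F"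
  by (auto simp: U_algebra_def quotient_algebra_def FactRing_def A_RCOSETS_def')

lemma U_add:
  "f \<in> carrier F \<Longrightarrow> g \<in> carrier F \<Longrightarrow>
     (J +>\<^bsub>F\<^esub> f) \<oplus>\<^bsub>U_algebra I E\<^esub> (J +>\<^bsub>F\<^esub> g) = J +>\<^bsub>F\<^esub> (f \<oplus>\<^bsub>F\<^esub> g)"
  by (simp add: U_algebra_def quotient_algebra_def FactRing_def J.a_rcos_sum)

lemma U_mult:
  "f \<in> carrier F \<Longrightarrow> g \<in> carrier F \<Longrightarrow>
     (J +>\<^bsub>F\<^esub> f) \<otimes>\<^bsub>U_algebra I E\<^esub> (J +>\<^bsub>F\<^esub> g) = J +>\<^bsub>F\<^esub> (f \<otimes>\<^bsub>F\<^esub> g)"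
  by (simp add: U_algebra_def quotient_algebra_def FactRing_def J.rcoset_mult_add)

lemma U_smult:
  assumes "f \<in> carrier F"
  shows "c \<odot>\<^bsub>U_algebra I E\<^esub> (J +>\<^bsub>F\<^esub> f) = J +>\<^bsub>F\<^esub> (c \<odot>\<^bsub>F\<^esub> f)"
proof -
  \<comment> \<open>Scalar multiplication of cosets is defined as a union over representatives. All
    its members coincide, so the union collapses to one coset.\<close>
  have const: "J +>\<^bsub>F\<^esub> (c \<odot>\<^bsub>F\<^esub> b) = J +>\<^bsub>F\<^esub> (c \<odot>\<^bsub>F\<^esub> f)" if b: "b \<in> J +>\<^bsub>F\<^esub> f" for b
  proof -
    have bF: "b \<in> carrier F" using J.a_elemrcos_carrier[OF assms b] .
    have "J +>\<^bsub>F\<^esub> f = J +>\<^bsub>F\<^esub> b"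
      by (rule F.a_repr_independence[OF b assms J.a_subgroup])
    then have "psi f = psi b" using coset_eq_iff[OF assms bF] by simp
    then show ?thesis
      using coset_eq_iff[OF smult_in_F[OF bF] smult_in_F[OF assms]] by (simp add: F_smult psi_smult)
  qed
  have "(\<Union>b \<in> J +>\<^bsub>F\<^esub> f. J +>\<^bsub>F\<^esub> (c \<odot>\<^bsub>F\<^esub> b)) = J +>\<^bsub>F\<^esub> (c \<odot>\<^bsub>F\<^esub> f)"
    using J.a_rcos_self[OF assms] by (intro SUP_eq_const const) blast+
  then show ?thesis by (simp add: U_algebra_def quotient_algebra_def)
qed

lemma U_word_eq: "u \<in> lists I \<Longrightarrow> U_word I E u = J +>\<^bsub>F\<^esub> basis_elt u"
proof (induction u)
  case Nil
  then show ?case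
    by (simp add: U_word_def list_prod_def U_algebra_def quotient_algebra_def FactRing_def F_one)
next
  case (Cons a u)
  then show ?case using U_mult[OF basis_in_F[of "[a]"] basis_in_F[of u]]
    by (simp add: U_word_def list_prod_def U_gen_def F_basis_mult)
qed

lemma phi_iso: "phi \<in> vector_space_iso (U_algebra I E) (coxeter_algebra I E)"
proof -
  have "bij_betw phi (carrier (U_algebra I E)) (carrier (coxeter_algebra I E))"
  proof (rule bij_betwI')
    fix A B assume "A \<in> carrier (U_algebra I E)" "B \<in> carrier (U_algebra I E)"
    then obtain f g where "f \<in> carrier F" "g \<in> carrier F" "A = J +>\<^bsub>F\<^esub> f" "B = J +>\<^bsub>F\<^esub> g"
      unfolding U_carrier by blast
    then show "phi A = phi B \<longleftrightarrow> A = B" by (simp add: phi_coset coset_eq_iff)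
  next
    fix A assume "A \<in> carrier (U_algebra I E)"
    then show "phi A \<in> carrier (coxeter_algebra I E)"
      unfolding U_carrier by (auto simp: phi_coset psi_closed)
  next
    fix g assume g: "g \<in> carrier (coxeter_algebra I E)"
    then have "g = phi (J +>\<^bsub>F\<^esub> sect g)" by (simp add: phi_coset sect_closed psi_sect)
    then show "\<exists>A\<in>carrier (U_algebra I E). g = phi A"
      unfolding U_carrier using sect_closed[OF g] by blast
  qed
  moreover have "phi (A \<oplus>\<^bsub>U_algebra I E\<^esub> B) = phi A \<oplus>\<^bsub>coxeter_algebra I E\<^esub> phi B"
    if AB: "A \<in> carrier (U_algebra I E)" "B \<in> carrier (U_algebra I E)" for A B
  proof -
    obtain f g where fg: "f \<in> carrier F" "g \<in> carrier F" "A = J +>\<^bsub>F\<^esub> f" "B = J +>\<^bsub>F\<^esub> g"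
      using AB unfolding U_carrier by blast
    then show ?thesis using F.a_closed[OF fg(1,2)] psi_add[OF fg(1,2)]
      by (simp add: U_add phi_coset) (simp add: F_add coxeter_algebra_def monoid_algebra_def)
  qed
  moreover have "phi (c \<odot>\<^bsub>U_algebra I E\<^esub> A) = c \<odot>\<^bsub>coxeter_algebra I E\<^esub> phi A"
    if A: "A \<in> carrier (U_algebra I E)" for c A
  proof -
    obtain f where f: "f \<in> carrier F" "A = J +>\<^bsub>F\<^esub> f" using A unfolding U_carrier by blast
    then show ?thesis using smult_in_F[OF f(1), of c] psi_smult[of c f]
      by (simp add: U_smult phi_coset F_smult coxeter_algebra_def monoid_algebra_def)
  qed
  ultimately show ?thesis by (simp add: vector_space_iso_def)
qed

lemma list_prod_coxeter_algebra:
  "u \<in> lists I \<Longrightarrow>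
     list_prod (coxeter_algebra I E) (map (\<lambda>i. basis_elt (coxeter_gen I E i)) u) = basis_elt (cox u)"
proof (induction u)
  case Nil
  then show ?case
    by (simp add: list_prod_def coxeter_algebra_def monoid_algebra_def cox_Nil basis_elt_def)
next
  case (Cons a u)
  then show ?case using cox_mult[of "[a]" u]
    by (simp add: list_prod_def) (simp add: coxeter_algebra_def basis_elt_mult cox_single)
qed

lemma phi_max_word:
  assumes "c \<in> pc_monoid' I E"
  shows "phi (U_word I E (max_word r c)) =
    list_prod (coxeter_algebra I E) (map (\<lambda>i. basis_elt (coxeter_gen I E i)) (max_word r c))"
proof -
  let ?u = "max_word r c"
  note u = pc_monoid'_max_word[OF assms]
  \<comment> \<open>The word is its own largest word, so the two signs are equal and multiply to
    1.\<close>
  have "psi (basis_elt ?u) = basis_elt (cox ?u)"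
    using u unfolding psi_def pairing_basis psi_coeff_def
    by (auto simp: basis_elt_def inv_sign_square)
  then show ?thesis
    using u(1) by (simp add: list_prod_coxeter_algebra U_word_eq phi_coset basis_in_F)
qed

text \<open>\<open>psi\<close> sends a reduced word to a multiple of an element whose weight is the
  multiset of that word, and kills the others. \<open>sect\<close> returns to words of the same
  multiset.\<close>

lemma phi_component: "phi ` U_component I E \<alpha> = coxeter_component I E \<alpha>"
proof -
  have hom: "f \<in> homogeneous (free_monoid I) mset \<alpha> \<longleftrightarrow> f \<in> carrier F \<and> (\<forall>u. f u \<noteq> 0 \<longrightarrow> mset u = \<alpha>)" for f
    by (simp add: homogeneous_def free_algebra_def)
  have hom': "g \<in> coxeter_component I E \<alpha> \<longleftrightarrow>
      g \<in> carrier (coxeter_algebra I E) \<and> (\<forall>w. g w \<noteq> 0 \<longrightarrow> coxeter_weight I E w = \<alpha>)" for g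
    by (simp add: coxeter_component_def homogeneous_def coxeter_algebra_def)
  have "phi ` U_component I E \<alpha> = psi ` homogeneous (free_monoid I) mset \<alpha>"
    unfolding U_component_def image_image by (rule image_cong) (auto simp: hom phi_coset)
  also have "\<dots> = coxeter_component I E \<alpha>"
  proof (intro equalityI subsetI)
    fix g assume "g \<in> psi ` homogeneous (free_monoid I) mset \<alpha>"
    then obtain f where f: "f \<in> carrier F" "\<forall>u. f u \<noteq> 0 \<longrightarrow> mset u = \<alpha>" "g = psi f"
      using hom by blast
    have "coxeter_weight I E w = \<alpha>" if "g w \<noteq> 0" for w
      using psi_nonzero[OF f(1), of w] that f coxeter_weight_cox by auto
    then show "g \<in> coxeter_component I E \<alpha>" using f psi_closed by (simp add: hom')
  next
    fix g assume g: "g \<in> coxeter_component I E \<alpha>"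
    have "mset u = \<alpha>" if "sect g u \<noteq> 0" for u
      using that g coxeter_weight_cox[of u]
      by (auto simp: sect_def hom' normal_words_def split: if_splits)
    then have "sect g \<in> homogeneous (free_monoid I) mset \<alpha>"
      using g sect_closed[of g] unfolding hom hom' by blast
    moreover have "g = psi (sect g)" using g by (simp add: hom' psi_sect)
    ultimately show "g \<in> psi ` homogeneous (free_monoid I) mset \<alpha>" by blast
  qed
  finally show ?thesis .
qed


section \<open>The generating series\<close>

abbreviation P :: "('i multiset \<Rightarrow> int) ring" where
  "P \<equiv> pow_series I"

sublocale P: cring P
  by (rule cring_pow_series)

lemma P_carrier: "f \<in> carrier P \<longleftrightarrow> (\<forall>m. f m \<noteq> 0 \<longrightarrow> set_mset m \<subseteq> I)"
  by (simp add: pow_series_def)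

lemma P_mult: "(f \<otimes>\<^bsub>P\<^esub> g) m = (\<Sum>k | k \<subseteq># m. f k * g (m - k))"
  by (simp add: pow_series_def)

lemma P_one: "\<one>\<^bsub>P\<^esub> = (\<lambda>m. if m = {#} then 1 else 0)"
  by (simp add: pow_series_def)

lemma P_add: "f \<oplus>\<^bsub>P\<^esub> g = (\<lambda>m. f m + g m)"
  by (simp add: pow_series_def)

section \<open>The sign-reversing involution\<close>

lemma independent_sets_insert:
  "insert i S \<in> independent_sets I E \<longleftrightarrow>
     i \<in> I \<and> S \<in> independent_sets I E \<and> (\<forall>j\<in>S. (i, j) \<notin> E)"
  by (auto simp: independent_sets_def E_commute)

text \<open>The common closed form of the negated independence series and of the sum over
  independent sets.\<close>

definition signed_indep :: "'i multiset \<Rightarrow> int" where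
  "signed_indep m = (if set_mset m \<in> independent_sets I E then (- 1) ^ size m else 0)"

lemma negate_independence_series: "negate_vars (independence_series I E) = signed_indep"
proof
  fix m :: "'i multiset"
  let ?A = "{U. set_mset U \<in> independent_sets I E}"
  have "{a. a \<in> ?A \<and> monomial a m \<noteq> 0} = (if m \<in> ?A then {m} else {})"
    by (auto simp: monomial_def)
  then have "independence_series I E m = (if m \<in> ?A then 1 else 0)"
    unfolding independence_series_def formal_sum_def by (simp add: monomial_def)
  then show "negate_vars (independence_series I E) m = signed_indep m"
    by (simp add: negate_vars_def signed_indep_def)
qed

lemma signed_indep_closed: "signed_indep \<in> carrier P"
  by (auto simp: P_carrier signed_indep_def independent_sets_def)

text \<open>In a pair with total monomial \<open>m\<close>, the word determines the multiset as
  \<open>m - mset u\<close>. Multiset subtraction truncates, hence the inclusion.\<close>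

definition words_below :: "'i multiset \<Rightarrow> 'i list set" where
  "words_below m = {u \<in> normal_words. mset u \<subseteq># m}"

lemma finite_words_below: "finite (words_below m)"
proof (rule finite_subset)
  show "words_below m \<subseteq> {u. set u \<subseteq> set_mset m \<and> length u \<le> size m}"
    using size_mset_mono set_mset_mono by (fastforce simp: words_below_def)
  show "finite {u. set u \<subseteq> set_mset m \<and> length u \<le> size m}"
    by (rule finite_lists_length_le) simp
qed

lemma coxeter_series_eq: "coxeter_series I E m = int (card {u \<in> normal_words. mset u = m})"
proof -
  let ?B = "{w \<in> carrier (coxeter_group I E). coxeter_weight I E w = m}"
  have eq: "{w. w \<in> carrier (coxeter_group I E) \<and> monomial (coxeter_weight I E w) m \<noteq> 0} = ?B"
    by (auto simp: monomial_def)
  have "coxeter_series I E m = (\<Sum>w\<in>?B. 1)"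
    unfolding coxeter_series_def formal_sum_def eq by (rule sum.cong) (auto simp: monomial_def)
  also have "\<dots> = int (card ?B)" by simp
  also have "bij_betw cox {u \<in> normal_words. mset u = m} ?B"
  proof (rule bij_betw_subset[OF bij_betw_cox, THEN bij_betw_cong[THEN iffD1, rotated]])
    show "cox ` {u \<in> normal_words. mset u = m} = ?B"
    proof (intro equalityI subsetI)
      fix w assume "w \<in> cox ` {u \<in> normal_words. mset u = m}"
      then show "w \<in> ?B"
        by (auto simp: normal_words_def cox_in_carrier coxeter_weight_cox)
    next
      fix w assume w: "w \<in> ?B"
      then obtain u where u: "u \<in> normal_words" "w = cox u"
        using bij_betw_imp_surj_on[OF bij_betw_cox] by blast
      then have "mset u = m" using w coxeter_weight_cox[of u] by (auto simp: normal_words_def)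
      then show "w \<in> cox ` {u \<in> normal_words. mset u = m}" using u by blast
    qed
  qed auto
  then have "card ?B = card {u \<in> normal_words. mset u = m}" by (simp add: bij_betw_same_card)
  finally show ?thesis by simp
qed

lemma coxeter_series_closed: "coxeter_series I E \<in> carrier P"
proof -
  have "set_mset m \<subseteq> I" if "coxeter_series I E m \<noteq> 0" for m
  proof -
    have "{u \<in> normal_words. mset u = m} \<noteq> {}"
      using that unfolding coxeter_series_eq by (metis card.empty of_nat_0)
    then show ?thesis by (auto simp: normal_words_def dest: in_listsD)
  qed
  then show ?thesis by (simp add: P_carrier)
qed

lemma coxeter_series_mult:
  "(coxeter_series I E \<otimes>\<^bsub>P\<^esub> signed_indep) m = (\<Sum>u\<in>words_below m. signed_indep (m - mset u))"
proof -
  have "(\<Sum>u\<in>words_below m. signed_indep (m - mset u)) =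
      (\<Sum>k | k \<subseteq># m. \<Sum>u | u \<in> words_below m \<and> mset u = k. signed_indep (m - mset u))"
    by (rule sum.group[OF finite_words_below finite_submultisets, symmetric])
      (auto simp: words_below_def)
  also have "\<dots> = (\<Sum>k | k \<subseteq># m. coxeter_series I E k * signed_indep (m - k))"
  proof (rule sum.cong[OF refl])
    fix k assume "k \<in> {k. k \<subseteq># m}"
    then have "{u. u \<in> words_below m \<and> mset u = k} = {u \<in> normal_words. mset u = k}"
      by (auto simp: words_below_def)
    then show "(\<Sum>u | u \<in> words_below m \<and> mset u = k. signed_indep (m - mset u)) =
        coxeter_series I E k * signed_indep (m - k)"
      by (simp add: coxeter_series_eq)
  qed
  finally show ?thesis by (simp add: P_mult)
qed

text \<open>The letters that can be moved between the word \<open>u\<close> and the independent multiset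
  \<open>m - mset u\<close>. Moving one of them does not change this set, so moving a letter that is
  selected from this set is a sign-reversing involution.\<close>

definition movable :: "'i multiset \<Rightarrow> 'i list \<Rightarrow> 'i set" where
  "movable m u = set_mset (m - mset u) \<union>
     {i \<in> I. initial E i u \<and> (\<forall>j \<in># m - mset u. (i, j) \<notin> E)}"

text \<open>\<open>left_mult\<close> yields some word of the new class; \<open>nf\<close> goes back
  to its normal word, so that applying \<open>move\<close> twice can give \<open>u\<close>
  itself.\<close>

definition move :: "'i multiset \<Rightarrow> 'i list \<Rightarrow> 'i list" where
  "move m u = nf (left_mult E (SOME i. i \<in> movable m u) u)"

definition move_dom :: "'i multiset \<Rightarrow> 'i list set" where
  "move_dom m = {u \<in> words_below m. set_mset (m - mset u) \<in> independent_sets I E}"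

lemma movable_pc: "u \<approx> v \<Longrightarrow> movable m u = movable m v"
  by (simp add: movable_def pc_mset initial_pc)

text \<open>For a letter other than \<open>i\<close>, non-adjacency to \<open>i\<close> is enforced
  by \<open>initial\<close> while \<open>i\<close> heads the word, and by the condition on the
  multiset once \<open>i\<close> lies there. The letter \<open>i\<close> itself is movable in either
  position.\<close>

lemma movable_left_mult:
  assumes u: "u \<in> move_dom m" and i: "i \<in> movable m u"
  shows "mset (left_mult E i u) \<subseteq># m"
    and "set_mset (m - mset (left_mult E i u)) \<in> independent_sets I E"
    and "movable m (left_mult E i u) = movable m u"
    and "(- 1 :: int) ^ size (m - mset (left_mult E i u)) = - ((- 1) ^ size (m - mset u))"
proof -
  define V where "V = m - mset u"
  define V' where "V' = m - mset (left_mult E i u)"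
  have ul: "u \<in> lists I" and sub: "mset u \<subseteq># m" and ind: "set_mset V \<in> independent_sets I E"
    using u by (auto simp: move_dom_def words_below_def normal_words_def V_def)
  have m: "m = V + mset u" using sub by (simp add: V_def)
  have "i \<in> I" using i ind by (auto simp: movable_def V_def independent_sets_def)
  have "mset (left_mult E i u) \<subseteq># m \<and> set_mset V' \<in> independent_sets I E \<and>
      movable m (left_mult E i u) = movable m u \<and> (- 1 :: int) ^ size V' = - ((- 1) ^ size V)"
  proof (cases "initial E i u")
    case True
    let ?v = "remove1 i u"
    have lm: "left_mult E i u = ?v" using True by (simp add: left_mult_def)
    have mu: "mset u = add_mset i (mset ?v)" using initial_in_set[OF True] by simp
    have V': "V' = add_mset i V" and subv: "mset ?v \<subseteq># m"
      unfolding V'_def lm m mu by (simp_all del: mset_remove1)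
    \<comment> \<open>If \<open>i\<close> is movable for its presence in the multiset, independence
      gives the claim; otherwise it is part of the definition.\<close>
    have nonadj: "\<forall>j \<in># V. (i, j) \<notin> E"
      using i ind unfolding movable_def V_def[symmetric] by (auto simp: independent_sets_def)
    have init: "initial E j u \<longleftrightarrow> i = j \<or> ((i, j) \<notin> E \<and> initial E j ?v)" for j
      using initial_pc[OF initial_to_front[OF True ul], of j] by simp
    have "movable m ?v = set_mset V' \<union> {j \<in> I. initial E j ?v \<and> (\<forall>k \<in># V'. (j, k) \<notin> E)}"
      by (simp add: movable_def V'_def lm)
    also have "\<dots> = set_mset V \<union> {j \<in> I. initial E j u \<and> (\<forall>k \<in># V. (j, k) \<notin> E)}"
      unfolding V' init using nonadj \<open>i \<in> I\<close> by (auto simp: E_commute)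
    also have "\<dots> = movable m u" by (simp add: movable_def V_def)
    finally show ?thesis
      using subv nonadj ind \<open>i \<in> I\<close> by (simp add: lm V' independent_sets_insert)
  next
    case False
    have lm: "left_mult E i u = i # u" using False by (simp add: left_mult_def)
    \<comment> \<open>A movable letter that is not initial must come from the multiset.\<close>
    have iV: "i \<in># V" using i False by (auto simp: movable_def V_def)
    have "V' = V - {#i#}" unfolding V_def V'_def lm by simp
    then have V: "V = add_mset i V'" using iV by simp
    have subv: "mset (i # u) \<subseteq># m"
      unfolding m V by simp
    have ind': "set_mset V' \<in> independent_sets I E" and nonadj: "\<forall>j \<in># V'. (i, j) \<notin> E"
      using ind unfolding V by (auto simp: independent_sets_insert)
    have "movable m (i # u) = set_mset V' \<union> {j \<in> I. initial E j (i # u) \<and> (\<forall>k \<in># V'. (j, k) \<notin> E)}"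
      by (simp add: movable_def V'_def lm)
    also have "\<dots> = set_mset V \<union> {j \<in> I. initial E j u \<and> (\<forall>k \<in># V. (j, k) \<notin> E)}"
      unfolding V using nonadj \<open>i \<in> I\<close> by (auto simp: E_commute)
    also have "\<dots> = movable m u" by (simp add: movable_def V_def)
    finally show ?thesis using subv ind' by (simp add: lm V)
  qed
  then show "mset (left_mult E i u) \<subseteq># m"
    and "set_mset (m - mset (left_mult E i u)) \<in> independent_sets I E"
    and "movable m (left_mult E i u) = movable m u"
    and "(- 1 :: int) ^ size (m - mset (left_mult E i u)) = - ((- 1) ^ size (m - mset u))"
    by (auto simp: V_def V'_def)
qed

lemma move:
  assumes "m \<noteq> {#}" and u: "u \<in> move_dom m"
  shows "move m u \<in> move_dom m" and "move m (move m u) = u"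
    and "signed_indep (m - mset (move m u)) = - signed_indep (m - mset u)"
proof -
  define i where "i = (SOME i. i \<in> movable m u)"
  have ul: "u \<in> lists I" and red: "reduced_word E u" and nfu: "nf u = u"
    and ind: "set_mset (m - mset u) \<in> independent_sets I E"
    using u by (auto simp: move_dom_def words_below_def normal_words_def)
  \<comment> \<open>Any letter of the multiset is movable. If the multiset is empty,
    \<open>u\<close> is not, and its first letter is movable with the adjacency condition
    vacuous.\<close>
  have "movable m u \<noteq> {}"
  proof (cases "m - mset u = {#}")
    case True
    with assms(1) u obtain a v where "u = a # v"
      by (cases u) (auto simp: move_dom_def words_below_def)
    then show ?thesis using ul True by (auto simp: movable_def)
  qed (auto simp: movable_def)
  then have i: "i \<in> movable m u" unfolding i_def by (simp add: some_in_eq)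
  then have "i \<in> I" using ind by (auto simp: movable_def independent_sets_def)
  let ?v = "left_mult E i u"
  have vl: "?v \<in> lists I" using \<open>i \<in> I\<close> ul by (rule left_mult_in_lists)
  have vred: "reduced_word E ?v" using ul red by (rule left_mult_reduced)
  have mv: "move m u = nf ?v" by (simp add: move_def i_def)
  have pc: "?v \<approx> move m u" unfolding mv by (rule nf_pc[OF vl])
  note lm = movable_left_mult[OF u i]
  show "move m u \<in> move_dom m"
    using lm(1,2) nf_normal[OF vl vred] pc_mset[OF pc] by (simp add: move_dom_def words_below_def mv)
  \<comment> \<open>With the set unchanged, the choice operator picks the same letter again.\<close>
  have "movable m (move m u) = movable m u" using movable_pc[OF pc] lm(3) by simp
  then have "move m (move m u) = nf (left_mult E i (move m u))"
    by (simp add: move_def[of m "move m u"] i_def)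
  also have "\<dots> = nf (left_mult E i ?v)"
    by (rule nf_eq[OF left_mult_pc[OF \<open>i \<in> I\<close> pc_sym[OF pc]]])
  also have "\<dots> = nf u" by (rule nf_eq[OF left_mult_left_mult[OF \<open>i \<in> I\<close> ul red]])
  finally show "move m (move m u) = u" using nfu by simp
  show "signed_indep (m - mset (move m u)) = - signed_indep (m - mset u)"
    using lm(2,4) ind pc_mset[OF pc] by (simp add: signed_indep_def)
qed

lemma coxeter_series_inverse: "coxeter_series I E \<otimes>\<^bsub>P\<^esub> signed_indep = \<one>\<^bsub>P\<^esub>"
proof
  fix m :: "'i multiset"
  have "(coxeter_series I E \<otimes>\<^bsub>P\<^esub> signed_indep) m = (\<Sum>u\<in>move_dom m. signed_indep (m - mset u))"
    unfolding coxeter_series_mult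
    by (rule sum.mono_neutral_right[OF finite_words_below])
      (auto simp: move_dom_def signed_indep_def)
  also have "\<dots> = \<one>\<^bsub>P\<^esub> m"
  proof (cases "m = {#}")
    case True
    have "[] \<in> normal_words" using nf_pc[of "[]"] pc_length[of "[]" "nf []"]
      by (simp add: normal_words_def)
    then have "move_dom m = {[]}"
      using True by (auto simp: move_dom_def words_below_def independent_sets_def)
    then show ?thesis using True by (simp add: P_one signed_indep_def independent_sets_def)
  next
    case False
    \<comment> \<open>The involution shows that the integer sum equals its own negative, hence
      vanishes.\<close>
    have "(\<Sum>u\<in>move_dom m. signed_indep (m - mset u)) =
        (\<Sum>u\<in>move_dom m. - signed_indep (m - mset u))"
      by (rule sum.reindex_bij_witness[of _ "move m" "move m"]) (use move[OF False] in auto)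
    then show ?thesis using False by (simp add: P_one sum_negf)
  qed
  finally show "(coxeter_series I E \<otimes>\<^bsub>P\<^esub> signed_indep) m = \<one>\<^bsub>P\<^esub> m" .
qed

lemma signed_indep_unit: "signed_indep \<in> Units P"
  and inv_signed_indep: "inv\<^bsub>P\<^esub> signed_indep = coxeter_series I E"
proof -
  have "signed_indep \<otimes>\<^bsub>P\<^esub> coxeter_series I E = \<one>\<^bsub>P\<^esub>"
    using coxeter_series_inverse signed_indep_closed coxeter_series_closed P.m_comm by metis
  then show "signed_indep \<in> Units P" "inv\<^bsub>P\<^esub> signed_indep = coxeter_series I E"
    using coxeter_series_inverse signed_indep_closed coxeter_series_closed
    by (auto simp: Units_def intro!: P.inv_char)
qed

section \<open>The expansion over independent sets\<close>

definition signed_support :: "'i set \<Rightarrow> 'i multiset \<Rightarrow> int" where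
  "signed_support S m = (if set_mset m = S then (- 1) ^ size m else 0)"

lemma P_var_mult:
  "((\<one>\<^bsub>P\<^esub> \<oplus>\<^bsub>P\<^esub> ps_var i) \<otimes>\<^bsub>P\<^esub> f) m = f m + (if i \<in># m then f (m - {#i#}) else 0)"
proof -
  let ?g = "\<lambda>k. (if k = {#} then f m else 0) + (if k = {#i#} then f (m - {#i#}) else 0)"
  have "((\<one>\<^bsub>P\<^esub> \<oplus>\<^bsub>P\<^esub> ps_var i) \<otimes>\<^bsub>P\<^esub> f) m = (\<Sum>k | k \<subseteq># m. ?g k)"
    unfolding P_mult by (intro sum.cong refl) (auto simp: P_one P_add ps_var_def monomial_def)
  also have "\<dots> = f m + (if i \<in># m then f (m - {#i#}) else 0)"
    by (simp add: sum.distrib finite_submultisets sum.delta)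
  finally show ?thesis .
qed

lemma ps_var_closed: "i \<in> I \<Longrightarrow> ps_var i \<in> carrier P"
  by (simp add: P_carrier ps_var_def monomial_def)

lemma one_plus_var_unit:
  assumes "i \<in> I"
  shows "\<one>\<^bsub>P\<^esub> \<oplus>\<^bsub>P\<^esub> ps_var i \<in> Units P"
proof -
  let ?y = "\<one>\<^bsub>P\<^esub> \<oplus>\<^bsub>P\<^esub> ps_var i"
  \<comment> \<open>The geometric series of -x_i; the inclusion in \<open>{i}\<close> admits the
    constant term.\<close>
  define g :: "'i multiset \<Rightarrow> int" where "g m = (if set_mset m \<subseteq> {i} then (- 1) ^ size m else 0)" for m
  have gc: "g \<in> carrier P" using assms by (auto simp: P_carrier g_def)
  have yc: "?y \<in> carrier P" using assms by (simp add: ps_var_closed)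
  have "?y \<otimes>\<^bsub>P\<^esub> g = \<one>\<^bsub>P\<^esub>"
  proof
    fix m
    show "(?y \<otimes>\<^bsub>P\<^esub> g) m = \<one>\<^bsub>P\<^esub> m"
    proof (cases "i \<in># m")
      case True
      then obtain k where "m = add_mset i k" by (metis insert_DiffM)
      then show ?thesis unfolding P_var_mult by (simp add: P_one g_def)
    next
      case False
      then have "set_mset m \<subseteq> {i} \<longleftrightarrow> set_mset m = {}" by auto
      then show ?thesis using False unfolding P_var_mult by (simp add: P_one g_def)
    qed
  qed
  then show ?thesis using gc yc P.m_comm[OF gc yc] by (auto simp: Units_def)
qed

text \<open>The series -x_i / (1 + x_i) is the sum of (-x_i)^n over n \<ge> 1, whence the support
  exactly \<open>{i}\<close>. The identity is checked after clearing the denominator.\<close>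

lemma signed_support_single:
  assumes "i \<in> I"
  shows "(\<ominus>\<^bsub>P\<^esub> ps_var i) \<otimes>\<^bsub>P\<^esub> inv\<^bsub>P\<^esub> (\<one>\<^bsub>P\<^esub> \<oplus>\<^bsub>P\<^esub> ps_var i) = signed_support {i}"
proof -
  let ?y = "\<one>\<^bsub>P\<^esub> \<oplus>\<^bsub>P\<^esub> ps_var i" and ?s = "signed_support {i}"
  have y: "?y \<in> Units P" using assms by (rule one_plus_var_unit)
  then have yc: "?y \<in> carrier P" by (rule P.Units_closed)
  have sc: "?s \<in> carrier P" using assms by (auto simp: P_carrier signed_support_def)
  have "\<ominus>\<^bsub>P\<^esub> ps_var i = (\<lambda>m. - ps_var i m)"
    by (rule P.minus_equality)
      (use ps_var_closed[OF assms] in \<open>auto simp: P_carrier P_add\<close>, simp add: pow_series_def)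
  \<comment> \<open>At x_i^n the contributions (-1)^n and (-1)^(n-1) cancel, except for n = 1, where
    the second is absent.\<close>
  also have "\<dots> = ?y \<otimes>\<^bsub>P\<^esub> ?s"
  proof
    fix m
    show "- ps_var i m = (?y \<otimes>\<^bsub>P\<^esub> ?s) m"
    proof (cases "i \<in># m")
      case True
      then obtain k where k: "m = add_mset i k" by (metis insert_DiffM)
      have "k = {#} \<longleftrightarrow> set_mset k = {}" by simp
      then show ?thesis
        unfolding P_var_mult by (auto simp: k signed_support_def ps_var_def monomial_def)
    next
      case False
      then show ?thesis
        unfolding P_var_mult by (auto simp: signed_support_def ps_var_def monomial_def)
    qed
  qed
  finally have "\<ominus>\<^bsub>P\<^esub> ps_var i = ?s \<otimes>\<^bsub>P\<^esub> ?y" using P.m_comm[OF sc yc] by simp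
  then show ?thesis using y yc sc by (simp add: P.m_assoc P.Units_r_inv)
qed

text \<open>Since \<open>i\<close> is not in \<open>S\<close>, a monomial has at most one
  contributing factorisation: all copies of \<open>i\<close> on the left and the rest on the
  right.\<close>

lemma signed_support_mult:
  assumes "i \<notin> S"
  shows "signed_support {i} \<otimes>\<^bsub>P\<^esub> signed_support S = signed_support (insert i S)"
proof
  fix m :: "'i multiset"
  let ?k = "filter_mset (\<lambda>j. j = i) m"
  have uniq: "k = ?k \<and> set_mset m = insert i S"
    if "k \<subseteq># m" "set_mset k = {i}" "set_mset (m - k) = S" for k
  proof
    have m: "m = k + (m - k)" using that(1) by simp
    have "?k = filter_mset (\<lambda>j. j = i) k + filter_mset (\<lambda>j. j = i) (m - k)"
      using m by (metis filter_union_mset)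
    also have "filter_mset (\<lambda>j. j = i) k = k" using that(2) by (auto simp: filter_mset_eq_conv)
    also have "filter_mset (\<lambda>j. j = i) (m - k) = {#}"
      using that(3) assms by (auto simp: multiset_eq_iff not_in_iff)
    finally show "k = ?k" by simp
    show "set_mset m = insert i S" using m that by (metis set_mset_union insert_is_Un)
  qed
  show "(signed_support {i} \<otimes>\<^bsub>P\<^esub> signed_support S) m = signed_support (insert i S) m"
  proof (cases "set_mset m = insert i S")
    case False
    then have "signed_support {i} k * signed_support S (m - k) = 0" if "k \<subseteq># m" for k
      using uniq[OF that] by (auto simp: signed_support_def)
    then have "(signed_support {i} \<otimes>\<^bsub>P\<^esub> signed_support S) m = 0"
      unfolding P_mult by (intro sum.neutral) blast
    then show ?thesis using False by (simp add: signed_support_def[of "insert i S"])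
  next
    case True
    have k: "?k \<subseteq># m" "set_mset ?k = {i}" "set_mset (m - ?k) = S"
    proof -
      show "?k \<subseteq># m" by simp
      show "set_mset ?k = {i}" using True by auto
      have "m - ?k = filter_mset (\<lambda>j. j \<noteq> i) m" by (metis add_diff_cancel_left' multiset_partition)
      then show "set_mset (m - ?k) = S" using True assms by auto
    qed
    have "(signed_support {i} \<otimes>\<^bsub>P\<^esub> signed_support S) m =
        (\<Sum>k\<in>{?k}. signed_support {i} k * signed_support S (m - k))"
      unfolding P_mult
    proof (rule sum.mono_neutral_right)
      show "\<forall>l\<in>{k. k \<subseteq># m} - {?k}. signed_support {i} l * signed_support S (m - l) = 0"
        using uniq by (auto simp: signed_support_def)
    qed (use k in \<open>auto simp: finite_submultisets\<close>)
    also have "\<dots> = (- 1) ^ (size ?k + size (m - ?k))"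
      using k by (simp add: signed_support_def power_add)
    also have "size ?k + size (m - ?k) = size m"
      using k(1) by (metis size_union subset_mset.add_diff_inverse)
    finally show ?thesis using True by (simp add: signed_support_def[of "insert i S"])
  qed
qed

lemma finprod_signed_support:
  assumes "finite S" "S \<subseteq> I"
  shows "(\<Otimes>\<^bsub>P\<^esub>i\<in>S. (\<ominus>\<^bsub>P\<^esub> ps_var i) \<otimes>\<^bsub>P\<^esub> inv\<^bsub>P\<^esub> (\<one>\<^bsub>P\<^esub> \<oplus>\<^bsub>P\<^esub> ps_var i)) = signed_support S"
  using assms
proof (induction S)
  case empty
  show ?case by (auto simp: P_one signed_support_def)
next
  case (insert i S)
  have "(\<ominus>\<^bsub>P\<^esub> ps_var j) \<otimes>\<^bsub>P\<^esub> inv\<^bsub>P\<^esub> (\<one>\<^bsub>P\<^esub> \<oplus>\<^bsub>P\<^esub> ps_var j) \<in> carrier P" if "j \<in> I" for j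
    using that one_plus_var_unit ps_var_closed by simp
  then show ?case
    using insert by (subst P.finprod_insert) (auto simp: signed_support_single signed_support_mult)
qed

lemma independent_set_series_eq: "independent_set_series I E = signed_indep"
proof
  fix m :: "'i multiset"
  let ?f = "\<lambda>S. \<Otimes>\<^bsub>P\<^esub>i\<in>S. (\<ominus>\<^bsub>P\<^esub> ps_var i) \<otimes>\<^bsub>P\<^esub> inv\<^bsub>P\<^esub> (\<one>\<^bsub>P\<^esub> \<oplus>\<^bsub>P\<^esub> ps_var i)"
  have f: "?f S = signed_support S" if "S \<in> independent_sets I E" for S
    using that by (intro finprod_signed_support) (auto simp: independent_sets_def)
  \<comment> \<open>A monomial occurs in the term of its own support and in no other, so the formal
    sum reduces to one term.\<close>
  then have "{S. S \<in> independent_sets I E \<and> ?f S m \<noteq> 0} =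
      (if set_mset m \<in> independent_sets I E then {set_mset m} else {})"
    by (auto simp: signed_support_def split: if_splits)
  then show "independent_set_series I E m = signed_indep m"
    unfolding independent_set_series_def Let_def formal_sum_def
    by (simp add: f signed_support_def signed_indep_def)
qed

end

theorem theorem6p2:
  fixes I :: "'i set" and E r :: "('i \<times> 'i) set"
  assumes "countable I"
    and "E \<subseteq> I \<times> I" and "sym E" and "irrefl E"
    and "linear_order_on I r"
  shows "(\<exists>\<phi> \<in> vector_space_iso (U_algebra I E) (coxeter_algebra I E).
            (\<forall>c \<in> pc_monoid' I E.
               \<phi> (U_word I E (max_word r c)) =
               list_prod (coxeter_algebra I E)
                 (map (\<lambda>i. basis_elt (coxeter_gen I E i)) (max_word r c))) \<and>
            (\<forall>\<alpha>. set_mset \<alpha> \<subseteq> I \<longrightarrow> \<phi> ` U_component I E \<alpha> = coxeter_component I E \<alpha>)) \<and>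
         negate_vars (independence_series I E) \<in> Units (pow_series I) \<and>
         independent_set_series I E \<in> Units (pow_series I) \<and>
         coxeter_series I E = inv\<^bsub>pow_series I\<^esub> (negate_vars (independence_series I E)) \<and>
         inv\<^bsub>pow_series I\<^esub> (negate_vars (independence_series I E)) =
           inv\<^bsub>pow_series I\<^esub> (independent_set_series I E)"
proof -
  interpret odd_graph I E r by (rule odd_graph.intro) (fact assms)+
  show ?thesis
    unfolding negate_independence_series independent_set_series_eq inv_signed_indep
    by (intro conjI bexI[OF _ phi_iso] ballI allI impI refl signed_indep_unit phi_max_word
        phi_component)
qed

end
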